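(* Let $\Gamma$ be a negative definite plumbing tree (all genera zero) with exactly two nodes $E_0$ and $\widetilde E_0$, with the notations of the context. For any $h\in H$, and for any integral vector $\mathbf c=(c_0,\widetilde c_0,\overline c,c_i,\widetilde c_j)$ giving a lift of $h$ (with associated pair $(c,\widetilde c)$), one has $$Z_h(t,\widetilde t)=\sum_{(\ell,\widetilde\ell)\in\mathcal S_{\mathbf c}}t^{\ell+c}\,\widetilde t^{\,\widetilde\ell+\widetilde c},$$ where $$\mathcal S_{\mathbf c}:=\left\{(\ell,\widetilde\ell)\in\mathbb Z^2:\ N_{\mathbf c}(\ell,\widetilde\ell)\ge0,\ \widetilde N_{\mathbf c}(\ell,\widetilde\ell)\geq0\ \text{ and }\ \ell+\widetilde\omega_0\widetilde\ell\equiv\overline c\ (\mathrm{mod}\ \alpha_0)\right\}.$$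
   Context: **Graph.** $\Gamma$ is a tree, all genera zero, integer decorations, with negative definite intersection form $(\,,\,)$ on $L=\bigoplus_v\mathbb ZE_v$. $L'=\{l'\in L\otimes\mathbb Q:(l',L)\subset\mathbb Z\}$, $H=L'/L$, $[l']$ the class of $l'$; $E_v^*\in L'$ with $(E_v^*,E_w)=-1$ if $v=w$, $0$ otherwise. $\Gamma$ has exactly two nodes (vertices of valency $\ge3$), $E_0$ and $\widetilde E_0$, with decorations $b_0$, $\widetilde b_0$, connected by a chain with vertices $\overline E_1,\dots,\overline E_s$ ($s\ge1$, $\overline E_1$ adjacent to $E_0$, $\overline E_s$ adjacent to $\widetilde E_0$). $E_0$ carries $d\geq 2$ further legs with end vertices $E_1,\dots,E_d$, and $\widetilde E_0$ carries $\widetilde d\ge2$ further legs with ends $\widetilde E_1,\dots,\widetilde E_{\widetilde d}$. Decorations of all non-nodes are $\le-2$. If the $i$-th leg at $E_0$ has decorations $-b_{i1},\dots,-b_{i\nu_i}$ (starting next to the node), its normalized Seifert invariant $(\alpha_i,\omega_i)$ is given by $\alpha_i/\omega_i=b_{i1}-1/(b_{i2}-1/(\cdots-1/b_{i\nu_i}))$, $0<\omega_i<\alpha_i$, $\gcd(\alpha_i,\omega_i)=1$; similarly $(\widetilde\alpha_j,\widetilde\omega_j)$ for the legs at $\widetilde E_0$. With $\det$ of a (sub)graph meaning the determinant of the negative of its intersection matrix ($=1$ for the empty graph): $\alpha_0=\det(\overline E_1,\dots,\overline E_s)$, $\omega_0=\det(\overline E_2,\dots,\overline E_s)$, $\widetilde\omega_0=\det(\overline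 E_1,\dots,\overline E_{s-1})$. **Series.** For $l'=\sum l'_vE_v$, $\mathbf t^{l'}=\prod_v t_v^{l'_v}$; $Z(\mathbf t)=\sum p_{l'}\mathbf t^{l'}$ is the Taylor expansion at the origin of $\prod_v(1-\mathbf t^{E_v^*})^{\delta_v-2}$ ($\delta_v$ the valency), and $Z_h(\mathbf t)=\sum_{[l']=h}p_{l'}\mathbf t^{l'}$. $Z_h(t,\widetilde t)$ is obtained from $Z_h(\mathbf t)$ by setting $t_v=1$ for all non-nodes $v$, where $t$, $\widetilde t$ are the variables of $E_0$, $\widetilde E_0$. **Lifts.** An integral vector $\mathbf c=(c_0,\widetilde c_0,\overline c,c_i\,(1\le i\le d),\widetilde c_j\,(1\le j\le\widetilde d))$ gives a lift of $h$ if the element $l'_{\mathbf c}=c_0E_0^*+\widetilde c_0\widetilde E_0^*+\overline c\,\overline E_1^*+\sum_ic_iE_i^*+\sum_j\widetilde c_j\widetilde E_j^*$ satisfies $[l'_{\mathbf c}]=h$ (every $h$ has such lifts). Put $c=-(E_0^*,l'_{\mathbf c})$, $\widetilde c=-(\widetilde E_0^*,l'_{\mathbf c})$ (the $E_0$- and $\widetilde E_0$-coefficients of $l'_{\mathbf c}$), and $$N_{\mathbf c}(\ell,\widetilde\ell)=c_0+\frac{\omega_0}{\alpha_0}\overline c-\Big(b_0+\frac{\omega_0}{\alpha_0}\Big)\ell-\frac1{\alpha_0}\widetilde\ell+\sum_i\Big\lfloor\frac{c_i-\omega_i\ell}{\alpha_i}\Big\rfloor,$$ $$\widetilde N_{\mathbf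 c}(\ell,\widetilde\ell)=\widetilde c_0+\frac1{\alpha_0}\overline c-\Big(\widetilde b_0+\frac{\widetilde\omega_0}{\alpha_0}\Big)\widetilde\ell-\frac1{\alpha_0}\ell+\sum_j\Big\lfloor\frac{\widetilde c_j-\widetilde\omega_j\widetilde\ell}{\widetilde\alpha_j}\Big\rfloor.$$ *)

theory Defs
  imports
    "HOL-Computational_Algebra.Formal_Power_Series"
    "HOL-Number_Theory.Cong"
    "Jordan_Normal_Form.Determinant"
begin

section \<open>Formal series with rational coefficients and arbitrary exponents\<close>

text \<open>
  A formal series with exponents in a type 'e is its coefficient function 'e => rat.
  In formal_sum the coefficient of each exponent is meant to receive only finitely many
  nonzero contributions. For connected negative definite graphs this holds for all sums
  formed below, because every coefficient of every dual vector is then strictly positive.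
\<close>

definition fmonom :: "rat \<Rightarrow> 'e \<Rightarrow> ('e \<Rightarrow> rat)" where
  "fmonom a e = (\<lambda>x. if x = e then a else 0)"

definition formal_sum :: "'i set \<Rightarrow> ('i \<Rightarrow> 'e \<Rightarrow> rat) \<Rightarrow> ('e \<Rightarrow> rat)" where
  "formal_sum I f = (\<lambda>e. \<Sum>i | i \<in> I \<and> f i e \<noteq> 0. f i e)"


section \<open>Plumbing graphs and their lattices\<close>

text \<open>
  The vertex set is the whole (finite) vertex type. All genera are zero, so the only
  decoration of a vertex is its Euler number. Elements of the rational span of the E_v
  are coefficient functions.
\<close>

record 'v plumbing =
  adj :: "'v \<Rightarrow> 'v \<Rightarrow> bool"
  dec :: "'v \<Rightarrow> int"

definition is_tree :: "('v::finite, 'z) plumbing_scheme \<Rightarrow> bool" where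
  "is_tree G \<longleftrightarrow>
     symp (adj G) \<and> irreflp (adj G) \<and>
     (\<forall>v w. (adj G)\<^sup>*\<^sup>* v w) \<and>
     \<not> (\<exists>xs. 3 \<le> length xs \<and> distinct xs \<and> successively (adj G) xs \<and>
              adj G (last xs) (hd xs))"

definition valency :: "('v::finite, 'z) plumbing_scheme \<Rightarrow> 'v \<Rightarrow> nat" where
  "valency G v = card {w. adj G v w}"

definition nodes :: "('v::finite, 'z) plumbing_scheme \<Rightarrow> 'v set" where
  "nodes G = {v. 3 \<le> valency G v}"

definition imat :: "('v::finite, 'z) plumbing_scheme \<Rightarrow> 'v \<Rightarrow> 'v \<Rightarrow> int" where
  "imat G v w = (if v = w then dec G v else if adj G v w then 1 else 0)"

definition iform :: "('v::finite, 'z) plumbing_scheme \<Rightarrow> ('v \<Rightarrow> rat) \<Rightarrow> ('v \<Rightarrow> rat) \<Rightarrow> rat" where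
  "iform G x y = (\<Sum>v\<in>UNIV. \<Sum>w\<in>UNIV. x v * of_int (imat G v w) * y w)"

definition basis_vec :: "'v \<Rightarrow> ('v \<Rightarrow> rat)" where
  "basis_vec v = (\<lambda>w. if w = v then 1 else 0)"

definition int_lattice :: "('v::finite, 'z) plumbing_scheme \<Rightarrow> ('v \<Rightarrow> rat) set" where
  "int_lattice G = {l. \<forall>v. l v \<in> \<int>}"

definition dual_lattice :: "('v::finite, 'z) plumbing_scheme \<Rightarrow> ('v \<Rightarrow> rat) set" where
  "dual_lattice G = {x. \<forall>l\<in>int_lattice G. iform G x l \<in> \<int>}"

definition negative_definite :: "('v::finite, 'z) plumbing_scheme \<Rightarrow> bool" where
  "negative_definite G \<longleftrightarrow> (\<forall>l\<in>int_lattice G. l \<noteq> (\<lambda>_. 0) \<longrightarrow> iform G l l < 0)"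

definition dual_vec :: "('v::finite, 'z) plumbing_scheme \<Rightarrow> 'v \<Rightarrow> ('v \<Rightarrow> rat)" where
  "dual_vec G v = (THE x. x \<in> dual_lattice G \<and>
     (\<forall>w. iform G x (basis_vec w) = (if v = w then - 1 else 0)))"

definition lattice_rel :: "('v::finite, 'z) plumbing_scheme \<Rightarrow> (('v \<Rightarrow> rat) \<times> ('v \<Rightarrow> rat)) set" where
  "lattice_rel G = {(x, y). x \<in> dual_lattice G \<and> y \<in> dual_lattice G \<and> x - y \<in> int_lattice G}"

definition disc_group :: "('v::finite, 'z) plumbing_scheme \<Rightarrow> ('v \<Rightarrow> rat) set set" where
  "disc_group G = dual_lattice G // lattice_rel G"

definition lclass :: "('v::finite, 'z) plumbing_scheme \<Rightarrow> ('v \<Rightarrow> rat) \<Rightarrow> ('v \<Rightarrow> rat) set" where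
  "lclass G x = lattice_rel G `` {x}"

text \<open>
  Determinant of the negative of the intersection matrix of the full subgraph on the
  vertices of a list; it is 1 for the empty list.
\<close>

definition subgraph_det :: "('v::finite, 'z) plumbing_scheme \<Rightarrow> 'v list \<Rightarrow> int" where
  "subgraph_det G xs =
     Determinant.det (Matrix.mat (length xs) (length xs) (\<lambda>(i, j). - imat G (xs ! i) (xs ! j)))"


section \<open>The series Z\<close>

text \<open>
  The factor of v is the power series of (1 - x)^(valency - 2) at x = t^(dual vector of v).
  Multiplying out all factors gives one term for each choice n of exponents.
\<close>

definition Zseries :: "('v::finite, 'z) plumbing_scheme \<Rightarrow> ('v \<Rightarrow> rat) \<Rightarrow> rat" where
  "Zseries G = formal_sum (UNIV :: ('v \<Rightarrow> nat) set)
     (\<lambda>n. fmonom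
        (\<Prod>v\<in>UNIV. fps_nth ((1 - fps_X) powi (int (valency G v) - 2)) (n v))
        (\<lambda>u. \<Sum>v\<in>UNIV. of_nat (n v) * dual_vec G v u))"

definition Zseries_part ::
    "('v::finite, 'z) plumbing_scheme \<Rightarrow> ('v \<Rightarrow> rat) set \<Rightarrow> ('v \<Rightarrow> rat) \<Rightarrow> rat" where
  "Zseries_part G h = formal_sum {x. lclass G x = h} (\<lambda>x. fmonom (Zseries G x) x)"


section \<open>Graphs with two nodes\<close>

text \<open>
  link lists the vertices of the chain from the vertex next to node to the vertex next
  to node'. Each leg is listed from the vertex next to its node to its end vertex.
  Legs are numbered from 0.
\<close>

record 'v two_node_plumbing = "'v plumbing" +
  node :: 'v
  node' :: 'v
  link :: "'v list"
  legs :: "'v list list"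
  legs' :: "'v list list"

definition consecutive :: "'v list \<Rightarrow> 'v \<Rightarrow> 'v \<Rightarrow> bool" where
  "consecutive xs v w \<longleftrightarrow> (\<exists>k. Suc k < length xs \<and> {v, w} = {xs ! k, xs ! Suc k})"

definition two_node_graph :: "'v::finite two_node_plumbing \<Rightarrow> bool" where
  "two_node_graph G \<longleftrightarrow>
     nodes G = {node G, node' G} \<and>
     link G \<noteq> [] \<and> 2 \<le> length (legs G) \<and> 2 \<le> length (legs' G) \<and>
     (\<forall>xs \<in> set (legs G) \<union> set (legs' G). xs \<noteq> []) \<and>
     distinct (node G # node' G # link G @ concat (legs G) @ concat (legs' G)) \<and>
     set (node G # node' G # link G @ concat (legs G) @ concat (legs' G)) = UNIV \<and>
     (\<forall>v w. adj G v w \<longleftrightarrow>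
        consecutive (node G # link G @ [node' G]) v w \<or>
        (\<exists>xs \<in> set (legs G). consecutive (node G # xs) v w) \<or>
        (\<exists>xs \<in> set (legs' G). consecutive (node' G # xs) v w)) \<and>
     (\<forall>v. v \<notin> nodes G \<longrightarrow> dec G v \<le> - 2)"

text \<open>Negative continued fraction b1 - 1/(b2 - 1/(...)).\<close>

fun neg_cfrac :: "int list \<Rightarrow> rat" where
  "neg_cfrac [] = 0"
| "neg_cfrac [b] = of_int b"
| "neg_cfrac (b # bs) = of_int b - 1 / neg_cfrac bs"

definition seifert_inv :: "'v::finite two_node_plumbing \<Rightarrow> 'v list \<Rightarrow> int \<times> int" where
  "seifert_inv G xs = (THE (\<alpha>, \<omega>).
     0 < \<omega> \<and> \<omega> < \<alpha> \<and> coprime \<alpha> \<omega> \<and>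
     of_int \<alpha> / of_int \<omega> = neg_cfrac (map (\<lambda>v. - dec G v) xs))"

definition leg_alpha :: "'v::finite two_node_plumbing \<Rightarrow> nat \<Rightarrow> int" where
  "leg_alpha G i = fst (seifert_inv G (legs G ! i))"

definition leg_omega :: "'v::finite two_node_plumbing \<Rightarrow> nat \<Rightarrow> int" where
  "leg_omega G i = snd (seifert_inv G (legs G ! i))"

definition leg_alpha' :: "'v::finite two_node_plumbing \<Rightarrow> nat \<Rightarrow> int" where
  "leg_alpha' G j = fst (seifert_inv G (legs' G ! j))"

definition leg_omega' :: "'v::finite two_node_plumbing \<Rightarrow> nat \<Rightarrow> int" where
  "leg_omega' G j = snd (seifert_inv G (legs' G ! j))"

definition alpha0 :: "'v::finite two_node_plumbing \<Rightarrow> int" where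
  "alpha0 G = subgraph_det G (link G)"

definition omega0 :: "'v::finite two_node_plumbing \<Rightarrow> int" where
  "omega0 G = subgraph_det G (tl (link G))"

definition omega0' :: "'v::finite two_node_plumbing \<Rightarrow> int" where
  "omega0' G = subgraph_det G (butlast (link G))"

text \<open>The series Z_h(t, t'), obtained by setting the variables of all non-nodes to 1.\<close>

definition Zseries_nodes ::
    "'v::finite two_node_plumbing \<Rightarrow> ('v \<Rightarrow> rat) set \<Rightarrow> rat \<times> rat \<Rightarrow> rat" where
  "Zseries_nodes G h = formal_sum UNIV
     (\<lambda>x. fmonom (Zseries_part G h x) (x (node G), x (node' G)))"


section \<open>Lifts\<close>

text \<open>Only the values cleg i and cleg' j at indices of legs are relevant.\<close>

record lift_vector =
  c0 :: int
  c0' :: int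
  cbar :: int
  cleg :: "nat \<Rightarrow> int"
  cleg' :: "nat \<Rightarrow> int"

definition lift_elem :: "'v::finite two_node_plumbing \<Rightarrow> lift_vector \<Rightarrow> ('v \<Rightarrow> rat)" where
  "lift_elem G c = (\<lambda>u.
       of_int (c0 c) * dual_vec G (node G) u
     + of_int (c0' c) * dual_vec G (node' G) u
     + of_int (cbar c) * dual_vec G (hd (link G)) u
     + (\<Sum>i<length (legs G). of_int (cleg c i) * dual_vec G (last (legs G ! i)) u)
     + (\<Sum>j<length (legs' G). of_int (cleg' c j) * dual_vec G (last (legs' G ! j)) u))"

definition gives_lift ::
    "'v::finite two_node_plumbing \<Rightarrow> lift_vector \<Rightarrow> ('v \<Rightarrow> rat) set \<Rightarrow> bool" where
  "gives_lift G c h \<longleftrightarrow> lclass G (lift_elem G c) = h"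

definition shift :: "'v::finite two_node_plumbing \<Rightarrow> lift_vector \<Rightarrow> rat" where
  "shift G c = - iform G (dual_vec G (node G)) (lift_elem G c)"

definition shift' :: "'v::finite two_node_plumbing \<Rightarrow> lift_vector \<Rightarrow> rat" where
  "shift' G c = - iform G (dual_vec G (node' G)) (lift_elem G c)"

definition Nfun :: "'v::finite two_node_plumbing \<Rightarrow> lift_vector \<Rightarrow> int \<Rightarrow> int \<Rightarrow> rat" where
  "Nfun G c l l' =
     of_int (c0 c)
     + of_int (omega0 G) / of_int (alpha0 G) * of_int (cbar c)
     - (of_int (dec G (node G)) + of_int (omega0 G) / of_int (alpha0 G)) * of_int l
     - 1 / of_int (alpha0 G) * of_int l'
     + (\<Sum>i<length (legs G).
          of_int \<lfloor>of_int (cleg c i - leg_omega G i * l) / (of_int (leg_alpha G i) :: rat)\<rfloor>)"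

definition Nfun' :: "'v::finite two_node_plumbing \<Rightarrow> lift_vector \<Rightarrow> int \<Rightarrow> int \<Rightarrow> rat" where
  "Nfun' G c l l' =
     of_int (c0' c)
     + 1 / of_int (alpha0 G) * of_int (cbar c)
     - (of_int (dec G (node' G)) + of_int (omega0' G) / of_int (alpha0 G)) * of_int l'
     - 1 / of_int (alpha0 G) * of_int l
     + (\<Sum>j<length (legs' G).
          of_int \<lfloor>of_int (cleg' c j - leg_omega' G j * l') / (of_int (leg_alpha' G j) :: rat)\<rfloor>)"

definition Sset :: "'v::finite two_node_plumbing \<Rightarrow> lift_vector \<Rightarrow> (int \<times> int) set" where
  "Sset G c = {(l, l'). 0 \<le> Nfun G c l l' \<and> 0 \<le> Nfun' G c l l' \<and>
     [l + omega0' G * l' = cbar c] (mod alpha0 G)}"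

end

theory Submission
  imports Defs "HOL-Analysis.Cartesian_Space"
begin

text \<open>
  Let h be the class of the lift. Every exponent x in h is the lift plus an integer vector l,
  and its coordinates -(x, E_v) with respect to the dual vectors are integers n_v(l), affine
  in l. The dual vectors form a basis, because a negative definite form is nondegenerate, so the
  coefficient of x in Z is the product over all vertices of the coefficient of X^(n_v(l)) in
  (1 - X)^(valency - 2) (lemma Zseries_coeff). At a vertex of valency 2 this factor is 1 if
  n_v(l) = 0 and 0 otherwise; at an end vertex it is 1 if n_v(l) \<ge> 0 and 0 otherwise. For
  integers r and r', the coefficient of the reduced series at (r, r'), shifted by the node
  coefficients of the lift, is therefore a sum over the integer vectors l that take the values
  r and r' at the nodes and satisfy these conditions along the link and the legs
  (lemmas Zseries_nodes_eq and weight_eq).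

  Along a chain the equations n_v(l) = 0 express each value of l by the two preceding ones, and
  the resulting coefficients are continuants, that is, determinants of subchains. On the link,
  the values r and r' leave exactly one rational solution, which is integral if and only if
  r + omega0' r' is congruent to cbar modulo alpha0; its first and last values yield the
  fractions with denominator alpha0 in N_c and N'_c (lemma solutions_link). On a leg with
  Seifert invariant (\<alpha>, \<omega>) and lift coefficient e the value y next to the node at value r is
  free, and the coordinate at the end vertex is \<alpha> y - \<omega> r + e. It is nonnegative exactly if
  k = y + \<lfloor>(e - \<omega> r) / \<alpha>\<rfloor> is a natural number (lemma leg_floor_nonneg_iff). So the
  contributing vectors l are parametrized by one natural number for each leg, without further
  restriction (lemmas inj_on_leg_params and leg_params_surj).

  In these parameters the coordinate at a node with d legs is N - (k_1 + ... + k_d), where N is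
  the value of N_c at (r, r'). Summing the coefficient of X^(N - k_1 - ... - k_d) in
  (1 - X)^(d - 1) over all k_1, ..., k_d gives the coefficient of X^N in
  (1 - X)^(d - 1) (1 - X)^(-d) = 1 / (1 - X), which is 1 if N \<ge> 0 and 0 otherwise
  (lemma sum_power_coeff). The legs at the two nodes are summed independently, so the
  coefficient at (r, r') is 1 exactly on the set S_c (lemma sum_weight).
\<close>

section \<open>Formal sums of monomials\<close>

lemma formal_sum_fmonom:
  "formal_sum I (\<lambda>i. fmonom (a i) (e i)) x = (\<Sum>i | i \<in> I \<and> e i = x \<and> a i \<noteq> 0. a i)"
proof -
  have "{i. i \<in> I \<and> fmonom (a i) (e i) x \<noteq> 0} = {i. i \<in> I \<and> e i = x \<and> a i \<noteq> 0}"
    by (auto simp: fmonom_def)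
  moreover have "(\<Sum>i | i \<in> I \<and> e i = x \<and> a i \<noteq> 0. fmonom (a i) (e i) x)
      = (\<Sum>i | i \<in> I \<and> e i = x \<and> a i \<noteq> 0. a i)"
    by (intro sum.cong) (auto simp: fmonom_def)
  ultimately show ?thesis by (simp add: formal_sum_def)
qed

section \<open>Coordinates with respect to the dual vectors\<close>

text \<open>
  Since (E_v^*, E_w) = -1 if v = w and 0 otherwise, these are the coefficients of x with respect
  to the dual vectors.
\<close>

definition coord :: "('v::finite, 'z) plumbing_scheme \<Rightarrow> ('v \<Rightarrow> rat) \<Rightarrow> 'v \<Rightarrow> rat" where
  "coord G x w = - iform G x (basis_vec w)"

lemma coord_expand: "coord G x w = - (\<Sum>v\<in>UNIV. x v * of_int (imat G v w))"
proof -
  have "(\<Sum>u\<in>UNIV. x v * of_int (imat G v u) * (basis_vec w u :: rat)) = x v * of_int (imat G v w)" for v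
    unfolding basis_vec_def by (simp add: if_distrib cong: if_cong)
  then show ?thesis by (simp add: coord_def iform_def)
qed

lemma iform_eq_coord: "iform G x y = - (\<Sum>w\<in>UNIV. coord G x w * y w)"
  unfolding iform_def coord_expand
  by (subst sum.swap) (simp add: sum_distrib_right sum_negf)

lemma coord_add: "coord G (\<lambda>u. x u + y u) w = coord G x w + coord G y w"
  by (simp add: coord_expand sum.distrib algebra_simps)

lemma coord_diff: "coord G (\<lambda>u. x u - y u) w = coord G x w - coord G y w"
  by (simp add: coord_expand sum_subtractf algebra_simps)

lemma coord_scale: "coord G (\<lambda>u. a * x u) w = a * coord G x w"
  by (simp add: coord_expand sum_distrib_left algebra_simps)

lemma coord_sum:
  "coord G (\<lambda>u. \<Sum>i\<in>I. f i u) w = (\<Sum>i\<in>I. coord G (f i) w)"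
  unfolding coord_expand sum_distrib_right
  by (subst sum.swap) (simp add: sum_negf)

lemma coord_of_int: "coord G (\<lambda>u. of_int (l u)) w = of_int (- (\<Sum>v\<in>UNIV. l v * imat G v w))"
  by (simp add: coord_expand)

lemma common_denominator:
  fixes x :: "'v::finite \<Rightarrow> rat"
  obtains D :: int where "D \<noteq> 0" "\<And>v. of_int D * x v \<in> \<int>"
proof
  let ?d = "\<lambda>v. snd (quotient_of (x v))"
  show "(\<Prod>v\<in>UNIV. ?d v) \<noteq> 0"
    by simp (metis less_irrefl quotient_of_denom_pos')
  fix v
  obtain p where p: "x v = of_int p / of_int (?d v)"
    using quotient_of_div by (metis surjective_pairing)
  have "?d v \<noteq> 0" by (metis less_irrefl quotient_of_denom_pos')
  moreover have "(\<Prod>v\<in>UNIV. ?d v) = ?d v * (\<Prod>v\<in>UNIV - {v}. ?d v)"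
    by (subst prod.remove[of _ v]) auto
  ultimately have "of_int (\<Prod>v\<in>UNIV. ?d v) * x v = of_int (p * (\<Prod>v\<in>UNIV - {v}. ?d v))"
    using p by (simp add: field_simps)
  then show "of_int (\<Prod>v\<in>UNIV. ?d v) * x v \<in> \<int>" by (metis Ints_of_int)
qed

text \<open>
  Negative definiteness is a condition on integer vectors; clearing denominators extends
  its consequences to rational ones.
\<close>

lemma coord_eq_0_imp:
  assumes "negative_definite G" and 0: "\<And>w. coord G x w = 0"
  shows "x v = 0"
proof -
  obtain D :: int where D: "D \<noteq> 0" "\<And>v. of_int D * x v \<in> \<int>"
    using common_denominator by blast
  let ?y = "\<lambda>v. of_int D * x v"
  have "?y \<in> int_lattice G" using D(2) by (simp add: int_lattice_def)
  moreover have "iform G ?y ?y = 0"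
    by (simp add: iform_eq_coord coord_scale 0)
  ultimately have "?y = (\<lambda>_. 0)"
    using assms(1) by (force simp: negative_definite_def)
  then show ?thesis using D(1) by (metis mult_eq_0_iff of_int_eq_0_iff)
qed

lemma coord_inject:
  assumes "negative_definite G" and "\<And>w. coord G x w = coord G y w"
  shows "x = y"
proof
  fix v show "x v = y v"
    using coord_eq_0_imp[of G "\<lambda>u. x u - y u" v] assms by (simp add: coord_diff)
qed

text \<open>
  The square matrix of the form is injective, hence surjective. This is what makes the dual
  vectors exist.
\<close>

lemma coord_surj:
  assumes "negative_definite G"
  shows "\<exists>x. \<forall>w. coord G x w = f w"
proof -
  let ?A = "Finite_Cartesian_Product.vec_lambda (\<lambda>w. Finite_Cartesian_Product.vec_lambda
     (\<lambda>v. - of_int (imat G v w))) :: rat ^ 'a ^ 'a"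
  have app: "vec_nth (?A *v x) w = coord G (vec_nth x) w" for x w
    by (simp add: matrix_vector_mult_def coord_expand sum_negf mult.commute)
  have "\<forall>x y. ?A *v x = ?A *v y \<longrightarrow> x = y"
    using coord_inject[OF assms] app by (metis vec_nth_inject)
  then have "surj ((*v) ?A)"
    by (metis matrix_left_invertible_injective matrix_left_right_inverse
        matrix_right_invertible_surjective inj_def)
  then obtain x where "?A *v x = Finite_Cartesian_Product.vec_lambda f"
    by (metis surjD)
  then show ?thesis using app by (metis vec_lambda_beta)
qed

lemma dual_lattice_iff: "x \<in> dual_lattice G \<longleftrightarrow> (\<forall>w. coord G x w \<in> \<int>)"
proof
  assume "x \<in> dual_lattice G"
  moreover have "basis_vec w \<in> int_lattice G" for w
    by (simp add: int_lattice_def basis_vec_def)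
  ultimately show "\<forall>w. coord G x w \<in> \<int>"
    by (simp add: coord_def dual_lattice_def)
next
  assume "\<forall>w. coord G x w \<in> \<int>"
  then show "x \<in> dual_lattice G"
    by (auto simp: dual_lattice_def int_lattice_def iform_eq_coord intro!: Ints_sum Ints_mult)
qed

lemma coord_dual_vec:
  assumes "negative_definite G"
  shows "coord G (dual_vec G v) w = (if v = w then 1 else 0)"
proof -
  obtain x where x: "\<And>w. coord G x w = (if v = w then 1 else 0)"
    using coord_surj[OF assms, of "\<lambda>w. if v = w then 1 else 0"] by blast
  have ipc: "iform G y (basis_vec w) = (if v = w then - 1 else 0)
      \<longleftrightarrow> coord G y w = (if v = w then 1 else 0)" for y w
    by (auto simp: coord_def)
  have "dual_vec G v = x"
    unfolding dual_vec_def ipc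
  proof (rule the_equality)
    show "x \<in> dual_lattice G \<and> (\<forall>w. coord G x w = (if v = w then 1 else 0))"
      using x by (auto simp: dual_lattice_iff)
  next
    fix y assume "y \<in> dual_lattice G \<and> (\<forall>w. coord G y w = (if v = w then 1 else 0))"
    then show "y = x" using x by (intro coord_inject[OF assms]) auto
  qed
  then show ?thesis using x by simp
qed

lemma coord_dual_comb:
  assumes "negative_definite G"
  shows "coord G (\<lambda>u. \<Sum>v\<in>UNIV. a v * dual_vec G v u) w = a w"
  by (simp add: coord_sum coord_scale coord_dual_vec[OF assms] if_distrib cong: if_cong)

section \<open>Coefficients of Z\<close>

text \<open>
  The coefficient of X^m in the factor of v, read as 0 for m < 0, so that it can be evaluated at
  an arbitrary integral coordinate.
\<close>

definition vertex_factor :: "('v::finite, 'z) plumbing_scheme \<Rightarrow> 'v \<Rightarrow> int \<Rightarrow> rat" where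
  "vertex_factor G v m = (if m < 0 then 0
     else fps_nth ((1 - fps_X) powi (int (valency G v) - 2)) (nat m))"

text \<open>
  A choice n of exponents contributes to the monomial of x exactly if n is the coordinate vector
  of x. So at most one choice contributes, and none does if some coordinate is negative.
\<close>

lemma Zseries_coeff:
  assumes "negative_definite G" and m: "\<And>v. coord G x v = of_int (m v)"
  shows "Zseries G x = (\<Prod>v\<in>UNIV. vertex_factor G v (m v))"
proof -
  let ?a = "\<lambda>n::'a \<Rightarrow> nat. \<Prod>v\<in>UNIV.
     fps_nth ((1 - fps_X) powi (int (valency G v) - 2) :: rat fps) (n v)"
  let ?e = "\<lambda>n::'a \<Rightarrow> nat. \<lambda>u. \<Sum>v\<in>UNIV. of_nat (n v) * dual_vec G v u"
  have ex: "?e n = x \<longleftrightarrow> (\<forall>v. int (n v) = m v)" for n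
  proof
    assume "?e n = x"
    then have "of_nat (n v) = (of_int (m v) :: rat)" for v
      using coord_dual_comb[OF assms(1), of "\<lambda>v. of_nat (n v)" v] m by simp
    then show "\<forall>v. int (n v) = m v" by (metis of_int_eq_iff of_int_of_nat_eq)
  next
    assume "\<forall>v. int (n v) = m v"
    then show "?e n = x"
      by (intro coord_inject[OF assms(1)])
        (metis coord_dual_comb[OF assms(1)] m of_int_of_nat_eq)
  qed
  have Z: "Zseries G x = (\<Sum>n | (\<forall>v. int (n v) = m v) \<and> ?a n \<noteq> 0. ?a n)"
    unfolding Zseries_def formal_sum_fmonom ex by simp
  show ?thesis
  proof (cases "\<forall>v. 0 \<le> m v")
    case True
    then have "{n. (\<forall>v. int (n v) = m v) \<and> ?a n \<noteq> 0}
        = (if ?a (\<lambda>v. nat (m v)) \<noteq> 0 then {\<lambda>v. nat (m v)} else {})"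
      by (auto simp: fun_eq_iff) (metis nat_int)+
    moreover have "?a (\<lambda>v. nat (m v)) = (\<Prod>v\<in>UNIV. vertex_factor G v (m v))"
      using True by (intro prod.cong) (auto simp: vertex_factor_def leD)
    ultimately show ?thesis using Z by simp
  next
    case False
    then obtain v where v: "m v < 0" by (meson not_le)
    then have "{n. (\<forall>v. int (n v) = m v) \<and> ?a n \<noteq> 0} = {}"
      by (auto simp: fun_eq_iff) (metis of_nat_0_le_iff not_less)
    moreover have "(\<Prod>v\<in>UNIV. vertex_factor G v (m v)) = 0"
      using v by (auto simp: vertex_factor_def intro!: prod_zero bexI[of _ v])
    ultimately show ?thesis by (simp only: Z sum.empty)
  qed
qed

lemma Zseries_part_eq:
  "Zseries_part G h x = (if lclass G x = h then Zseries G x else 0)"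
proof -
  have "{i. i \<in> {x. lclass G x = h} \<and> i = x \<and> Zseries G i \<noteq> 0}
      = (if lclass G x = h \<and> Zseries G x \<noteq> 0 then {x} else {})" by auto
  then show ?thesis by (simp add: Zseries_part_def formal_sum_fmonom)
qed

text \<open>
  A vector outside the dual lattice has an empty class, whereas y belongs to its own class; so
  equality of the classes already puts x into the dual lattice.
\<close>

lemma lclass_eq_iff:
  assumes "y \<in> dual_lattice G"
  shows "lclass G x = lclass G y \<longleftrightarrow> (\<exists>l. x = (\<lambda>u. y u + of_int (l u)))"
proof
  assume "lclass G x = lclass G y"
  moreover have "y \<in> lclass G y"
    using assms by (simp add: lclass_def lattice_rel_def int_lattice_def)
  ultimately have "(\<lambda>u. x u - y u) \<in> int_lattice G"
    by (auto simp: lclass_def lattice_rel_def fun_diff_def)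
  then have "\<forall>u. \<exists>k. x u - y u = of_int k" by (auto simp: int_lattice_def elim!: Ints_cases)
  then obtain l where "\<forall>u. x u - y u = of_int (l u)" by metis
  then show "\<exists>l. x = (\<lambda>u. y u + of_int (l u))"
    by (intro exI[of _ l]) (auto simp: fun_eq_iff algebra_simps)
next
  assume "\<exists>l. x = (\<lambda>u. y u + of_int (l u))"
  then obtain l where x: "x = (\<lambda>u. y u + of_int (l u))" ..
  have "x \<in> dual_lattice G"
    using assms by (simp add: x dual_lattice_iff coord_add coord_of_int del: of_int_minus of_int_sum of_int_mult)
  moreover have "x u - z u \<in> \<int> \<longleftrightarrow> y u - z u \<in> \<int>" for z u
  proof -
    have "x u - z u = (y u - z u) + of_int (l u)" by (simp add: x)
    then show ?thesis by (metis Ints_add Ints_diff Ints_of_int add_diff_cancel_right')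
  qed
  ultimately show "lclass G x = lclass G y"
    using assms by (auto simp: lclass_def lattice_rel_def int_lattice_def)
qed

section \<open>Continuants\<close>

fun continuant :: "int list \<Rightarrow> int" where
  "continuant [] = 1"
| "continuant [b] = b"
| "continuant (b # b' # bs) = b * continuant (b' # bs) - continuant bs"

definition tridiag :: "int list \<Rightarrow> int mat" where
  "tridiag bs = Matrix.mat (length bs) (length bs)
     (\<lambda>(i, j). if i = j then bs ! i else if i = Suc j \<or> j = Suc i then - 1 else 0)"

lemma tridiag_carrier: "tridiag bs \<in> carrier_mat (length bs) (length bs)"
  by (simp add: tridiag_def)

text \<open>
  Expansion along the first row. The second minor has only the entry -1 in its first column,
  and removing it leaves the matrix of the list without its first two entries.
\<close>

lemma det_tridiag: "Determinant.det (tridiag bs) = continuant bs"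
proof (induction bs rule: continuant.induct)
  case 1
  show ?case by (simp add: tridiag_def det_dim_zero)
next
  case (2 b)
  show ?case by (simp add: tridiag_def det_single)
next
  case (3 b b' bs)
  let ?A = "tridiag (b # b' # bs)"
  let ?n = "Suc (Suc (length bs))"
  let ?B = "mat_delete ?A 0 (Suc 0)"
  have A: "?A \<in> carrier_mat ?n ?n" using tridiag_carrier[of "b # b' # bs"] by simp
  have del0: "mat_delete ?A 0 0 = tridiag (b' # bs)"
    by (rule eq_matI) (auto simp: tridiag_def mat_delete_def)
  have del00: "mat_delete ?B 0 0 = tridiag bs"
    by (rule eq_matI) (auto simp: tridiag_def mat_delete_def)
  have B: "?B \<in> carrier_mat (Suc (length bs)) (Suc (length bs))"
    using mat_delete_carrier[OF A, of 0 "Suc 0"] by simp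
  have "Determinant.det ?B = (\<Sum>i<Suc (length bs). ?B $$ (i, 0) * cofactor ?B i 0)"
    by (rule laplace_expansion_column[OF B]) simp
  also have "\<dots> = (\<Sum>i\<in>{0}. ?B $$ (i, 0) * cofactor ?B i 0)"
    by (rule sum.mono_neutral_right) (auto simp: tridiag_def mat_delete_def)
  also have "\<dots> = - Determinant.det (tridiag bs)"
    by (simp add: cofactor_def del00) (simp add: tridiag_def mat_delete_def)
  finally have detB: "Determinant.det ?B = - continuant bs" using 3 by simp
  have "Determinant.det ?A = (\<Sum>j<?n. ?A $$ (0, j) * cofactor ?A 0 j)"
    by (rule laplace_expansion_row[OF A]) simp
  also have "\<dots> = (\<Sum>j\<in>{0, 1}. ?A $$ (0, j) * cofactor ?A 0 j)"
    by (rule sum.mono_neutral_right) (auto simp: tridiag_def)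
  also have "\<dots> = b * continuant (b' # bs) - continuant bs"
    using 3 detB by (simp add: cofactor_def del0) (simp add: tridiag_def)
  finally show ?case by simp
qed

text \<open>
  If all entries are at least 2, the recursion makes the continuants of the successive tails
  strictly decreasing down to 1.
\<close>

lemma continuant_gt_tl:
  assumes "bs \<noteq> []" "\<forall>b\<in>set bs. 2 \<le> b"
  shows "0 < continuant (tl bs) \<and> continuant (tl bs) < continuant bs"
  using assms
proof (induction bs rule: continuant.induct)
  case (3 b b' bs)
  let ?K = "continuant (b' # bs)"
  have IH: "0 < continuant bs" "continuant bs < ?K" using 3 by auto
  moreover have "2 * ?K \<le> b * ?K" using 3 IH by (intro mult_right_mono) auto
  ultimately have "?K < b * ?K - continuant bs" by linarith
  then show ?case using IH by simp
qed auto

lemma coprime_continuant_tl: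
  "bs \<noteq> [] \<Longrightarrow> coprime (continuant bs) (continuant (tl bs))"
proof (induction bs rule: continuant.induct)
  case (3 b b' bs)
  have cop: "coprime (continuant (b' # bs)) (continuant bs)" using 3 by simp
  have "coprime (b * continuant (b' # bs) - continuant bs) (continuant (b' # bs))"
  proof (rule coprimeI)
    fix d assume d: "d dvd b * continuant (b' # bs) - continuant bs" "d dvd continuant (b' # bs)"
    have "d dvd b * continuant (b' # bs) - (b * continuant (b' # bs) - continuant bs)"
      by (rule dvd_diff[OF dvd_mult[OF d(2)] d(1)])
    then have "d dvd continuant bs" by (metis diff_diff_eq2 add_diff_cancel_left')
    with d(2) cop show "is_unit d" by (metis coprime_common_divisor)
  qed
  then show ?case by simp
qed auto

lemma neg_cfrac_continuant:
  assumes "bs \<noteq> []" "\<forall>b\<in>set bs. 2 \<le> b"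
  shows "neg_cfrac bs = of_int (continuant bs) / of_int (continuant (tl bs))"
  using assms
proof (induction bs rule: continuant.induct)
  case (3 b b' bs)
  have "0 < continuant (b' # bs)"
    using continuant_gt_tl[of "b' # bs"] 3 by simp
  then have "(of_int (continuant (b' # bs)) :: rat) \<noteq> 0" by simp
  moreover have "neg_cfrac (b' # bs) = of_int (continuant (b' # bs)) / of_int (continuant bs)"
    using 3 by simp
  ultimately show ?case by (simp add: field_simps)
qed auto

lemma subgraph_det_path:
  assumes "distinct xs"
    and "\<And>i j. i < length xs \<Longrightarrow> j < length xs \<Longrightarrow>
      adj G (xs ! i) (xs ! j) \<longleftrightarrow> i = Suc j \<or> j = Suc i"
  shows "subgraph_det G xs = continuant (map (\<lambda>v. - dec G v) xs)"
proof -
  have "Matrix.mat (length xs) (length xs) (\<lambda>(i, j). - imat G (xs ! i) (xs ! j))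
      = tridiag (map (\<lambda>v. - dec G v) xs)"
    using assms by (intro eq_matI) (auto simp: tridiag_def imat_def nth_eq_iff_index_eq)
  then show ?thesis by (simp add: subgraph_det_def det_tridiag)
qed

text \<open>
  The continued fraction is the quotient of two coprime continuants, and a fraction in lowest
  terms with positive denominator is unique.
\<close>

lemma seifert_inv_eq:
  assumes "xs \<noteq> []" "\<And>v. v \<in> set xs \<Longrightarrow> dec G v \<le> - 2"
  defines "bs \<equiv> map (\<lambda>v. - dec G v) xs"
  shows "seifert_inv G xs = (continuant bs, continuant (tl bs))"
proof -
  have "2 \<le> - dec G v" if "v \<in> set xs" for v using assms(2)[OF that] by simp
  then have bs: "bs \<noteq> []" "\<forall>b\<in>set bs. 2 \<le> b"
    using assms(1) by (auto simp: bs_def)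
  note pos = continuant_gt_tl[OF bs] and cop = coprime_continuant_tl[OF bs(1)]
  have cf: "neg_cfrac bs = of_int (continuant bs) / of_int (continuant (tl bs))"
    by (rule neg_cfrac_continuant[OF bs])
  show ?thesis
    unfolding seifert_inv_def bs_def[symmetric]
  proof (rule the_equality)
    show "case (continuant bs, continuant (tl bs)) of (\<alpha>, \<omega>) \<Rightarrow>
       0 < \<omega> \<and> \<omega> < \<alpha> \<and> coprime \<alpha> \<omega> \<and> of_int \<alpha> / of_int \<omega> = neg_cfrac bs"
      using pos cop cf by simp
  next
    fix p :: "int \<times> int"
    obtain \<alpha> \<omega> where p: "p = (\<alpha>, \<omega>)" by fastforce
    assume "case p of (\<alpha>, \<omega>) \<Rightarrow>
       0 < \<omega> \<and> \<omega> < \<alpha> \<and> coprime \<alpha> \<omega> \<and> of_int \<alpha> / of_int \<omega> = neg_cfrac bs"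
    then have a: "0 < \<omega>" "coprime \<alpha> \<omega>" "of_int \<alpha> / of_int \<omega> = neg_cfrac bs" by (auto simp: p)
    have "of_int \<alpha> / of_int \<omega> = (of_int (continuant bs) / of_int (continuant (tl bs)) :: rat)"
      using a(3) cf by simp
    then have "(of_int (\<alpha> * continuant (tl bs)) :: rat) = of_int (continuant bs * \<omega>)"
      using a(1) pos by (subst (asm) frac_eq_eq) auto
    then have eq: "\<alpha> * continuant (tl bs) = continuant bs * \<omega>" by (simp only: of_int_eq_iff)
    then have "\<bar>\<alpha>\<bar> = \<bar>continuant bs\<bar> \<and> \<bar>continuant (tl bs)\<bar> = \<bar>\<omega>\<bar>"
      using coprime_crossproduct_int[OF a(2) cop] by (simp add: abs_mult[symmetric])
    then have "\<omega> = continuant (tl bs)" using a(1) pos by linarith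
    moreover have "\<alpha> = continuant bs" using eq calculation a(1) by simp
    ultimately show "p = (continuant bs, continuant (tl bs))" by (simp add: p)
  qed
qed

section \<open>Chain recursions\<close>

text \<open>
  The values u_1, ..., u_(s+1) determined by u_0 = a, u_1 = y and
  u_(k+1) = b_k u_k - u_(k-1). With b_k = - dec of the k-th vertex of a chain this says that
  u pairs to zero with all vertices of the chain (see propagate_iff).
\<close>

fun propagate :: "int list \<Rightarrow> int \<Rightarrow> int \<Rightarrow> int list" where
  "propagate [] a y = [y]"
| "propagate (b # bs) a y = y # propagate bs y (b * y - a)"

lemma length_propagate [simp]: "length (propagate bs a y) = Suc (length bs)"
  by (induction bs a y rule: propagate.induct) auto

lemma hd_propagate [simp]: "hd (propagate bs a y) = y"
  by (cases bs) auto

lemma propagate_not_Nil [simp]: "propagate bs a y \<noteq> []"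
  by (cases bs) auto

text \<open>
  Dropping the first step replaces (a, y) by (y, b y - a); the effect on the coefficients of the
  last value is the recursion of the continuant.
\<close>

lemma last_propagate:
  "bs \<noteq> [] \<Longrightarrow> last (propagate bs a y) = continuant bs * y - continuant (tl bs) * a"
proof (induction bs arbitrary: a y)
  case (Cons b bs)
  show ?case
  proof (cases bs)
    case (Cons b' cs)
    have K: "continuant (b # bs) = b * continuant bs - continuant (tl bs)"
      using Cons by simp
    have "last (propagate (b # bs) a y) = last (propagate bs y (b * y - a))" by simp
    also have "\<dots> = continuant bs * (b * y - a) - continuant (tl bs) * y"
      using Cons.IH Cons by blast
    also have "\<dots> = continuant (b # bs) * y - continuant (tl (b # bs)) * a"
      unfolding K by (simp add: algebra_simps)
    finally show ?thesis .
  qed simp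
qed simp

text \<open>
  Read from the far end, the recursion computes the initial value from the last two; dropping the
  last vertex instead of the first one gives the continuant of butlast in place of tl.
\<close>

lemma start_of_propagate:
  assumes "bs \<noteq> []" "propagate bs a y = us @ [z]"
  shows "a = continuant bs * last us - continuant (butlast bs) * z"
  using assms
proof (induction bs arbitrary: a y us rule: continuant.induct)
  case (3 b b' bs)
  obtain us' where us: "us = y # us'" and p: "propagate (b' # bs) y (b * y - a) = us' @ [z]"
    using "3.prems" by (cases us) auto
  show ?case
  proof (cases bs)
    case Nil
    then have us': "us' = [b * y - a]" and z: "z = b' * (b * y - a) - y" using p by auto
    show ?thesis unfolding Nil us us' z by (simp add: algebra_simps)
  next
    case (Cons b'' cs)
    obtain us'' where us': "us' = (b * y - a) # us''"
      and p': "propagate bs (b * y - a) (b' * (b * y - a) - y) = us'' @ [z]"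
      using p Cons by (cases us') auto
    have ne: "us'' \<noteq> []" using arg_cong[OF p', of length] Cons by auto
    have 1: "y = continuant (b' # bs) * last us - continuant (butlast (b' # bs)) * z"
      using "3.IH"(1)[OF _ p] us us' by simp
    have 2: "b * y - a = continuant bs * last us - continuant (butlast bs) * z"
      using "3.IH"(2)[OF _ p'] us us' ne Cons by simp
    have "a = b * y - (b * y - a)" by simp
    also have "\<dots> = b * (continuant (b' # bs) * last us - continuant (butlast (b' # bs)) * z)
        - (continuant bs * last us - continuant (butlast bs) * z)"
      by (simp only: 1[symmetric] 2[symmetric])
    also have "\<dots> = continuant (b # b' # bs) * last us - continuant (butlast (b # b' # bs)) * z"
      using Cons by (cases cs) (auto simp: algebra_simps)
    finally show ?thesis .
  qed
qed auto

text \<open>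
  In the recursion u_(k-1) has coefficient -1, so it can also be run backwards over the
  integers from arbitrary last two values.
\<close>

lemma propagate_backwards:
  assumes "bs \<noteq> []"
  shows "\<exists>a us. propagate bs a (hd us) = us @ [z] \<and> length us = length bs \<and> last us = x"
  using assms
proof (induction bs)
  case (Cons b bs)
  show ?case
  proof (cases "bs = []")
    case True
    then show ?thesis by (intro exI[of _ "b * x - z"] exI[of _ "[x]"]) simp
  next
    case False
    then obtain a us where us: "propagate bs a (hd us) = us @ [z]" "length us = length bs" "last us = x"
      using Cons by auto
    then have "us \<noteq> []" using False by auto
    then show ?thesis using us
      by (intro exI[of _ "b * a - hd us"] exI[of _ "a # us"]) simp
  qed
qed simp

lemma propagate_iff:
  assumes "length us = length bs" "bs \<noteq> []"
  shows "propagate bs a (hd us) = us @ [z] \<longleftrightarrow>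
    (\<forall>k<length bs. (a # us @ [z]) ! k + (a # us @ [z]) ! Suc (Suc k) = bs ! k * us ! k)"
  using assms
proof (induction bs arbitrary: a us)
  case (Cons b bs)
  obtain u us' where us: "us = u # us'" using Cons.prems by (cases us) auto
  show ?case
  proof (cases "bs = []")
    case True
    then show ?thesis using us Cons.prems by auto
  next
    case False
    have ne: "us' \<noteq> []" using False us Cons.prems by auto
    have split: "(\<forall>k<Suc n. P k) \<longleftrightarrow> P 0 \<and> (\<forall>k<n. P (Suc k))" for P and n :: nat
      by (auto simp: less_Suc_eq_0_disj)
    have "propagate (b # bs) a (hd us) = us @ [z]
        \<longleftrightarrow> propagate bs u (b * u - a) = us' @ [z]" by (simp add: us)
    also have "\<dots> \<longleftrightarrow> b * u - a = hd us' \<and> propagate bs u (hd us') = us' @ [z]"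
      using ne by (metis hd_append2 hd_propagate)
    also have "\<dots> \<longleftrightarrow> a + hd us' = b * u \<and> (\<forall>k<length bs. (u # us' @ [z]) ! k + (u # us' @ [z]) ! Suc (Suc k) = bs ! k * us' ! k)"
      using Cons.IH[of us' u] Cons.prems us False by auto
    finally show ?thesis using us ne
      by (simp add: split nth_append hd_conv_nth)
  qed
qed simp

section \<open>A generating function\<close>

text \<open>
  The number of lists of d natural numbers with sum m is the coefficient of X^m in
  (1 - X)^(-d). The sum is thus a coefficient of (1 - X)^(-d) (1 - X)^(d - 1) = 1 / (1 - X).
\<close>

lemma sum_power_coeff:
  fixes N :: int
  assumes "1 \<le> d"
  defines "f \<equiv> \<lambda>m::int. if m < 0 then 0 else fps_nth ((1 - fps_X) powi (int d - 1) :: rat fps) (nat m)"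
  shows "(\<Sum>ks | length ks = d \<and> f (N - int (sum_list ks)) \<noteq> 0. f (N - int (sum_list ks)))
    = (if 0 \<le> N then 1 else 0)"
proof (cases "0 \<le> N")
  case False
  then have "f (N - int m) = 0" for m by (simp add: f_def)
  then show ?thesis using False by simp
next
  case True
  then obtain n where n: "N = int n" using zero_le_imp_eq_int by blast
  define g :: "rat fps" where "g = Abs_fps (\<lambda>_. 1)"
  define p :: "rat fps" where "p = (1 - fps_X) ^ (d - 1)"
  have pp: "(1 - fps_X) powi (int d - 1) = p"
    using assms(1) by (simp add: p_def power_int_def nat_diff_distrib)
  have g1: "g * (1 - fps_X) = 1"
    unfolding g_def by (rule fps_ext) (auto simp: right_diff_distrib)
  have gd: "fps_nth (g ^ d) m = of_nat (card (natpermute m d))" for m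
  proof -
    obtain e where e: "d = Suc e" using assms(1) by (cases d) auto
    show ?thesis unfolding e fps_power_nth_Suc by (simp add: g_def)
  qed
  have gdp: "g ^ d * p = g"
  proof -
    have "g ^ d * p = g * (g * (1 - fps_X)) ^ (d - 1)"
      using assms(1) by (cases d) (auto simp: p_def power_mult_distrib mult.assoc)
    then show ?thesis by (simp add: g1)
  qed
  let ?T = "{ks. length ks = d \<and> sum_list ks \<le> n}"
  have T: "?T = (\<Union>m\<in>{0..n}. natpermute m d)" by (auto simp: natpermute_def)
  have fin: "finite ?T" unfolding T by (auto intro: natpermute_finite)
  have "(\<Sum>ks | length ks = d \<and> f (N - int (sum_list ks)) \<noteq> 0. f (N - int (sum_list ks)))
     = (\<Sum>ks\<in>?T. f (N - int (sum_list ks)))"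
    by (rule sum.mono_neutral_left[OF fin]) (auto simp: f_def n split: if_splits)
  also have "\<dots> = (\<Sum>m\<in>{0..n}. \<Sum>ks\<in>natpermute m d. f (N - int (sum_list ks)))"
  proof -
    have "\<forall>i\<in>{0..n}. \<forall>j\<in>{0..n}. i \<noteq> j \<longrightarrow> natpermute i d \<inter> natpermute j d = {}"
      by (auto simp: natpermute_def)
    then show ?thesis unfolding T by (intro sum.UNION_disjoint) (simp_all add: natpermute_finite)
  qed
  also have "\<dots> = (\<Sum>m\<in>{0..n}. fps_nth (g ^ d) m * fps_nth p (n - m))"
  proof (rule sum.cong[OF refl])
    fix m assume m: "m \<in> {0..n}"
    have "(\<Sum>ks\<in>natpermute m d. f (N - int (sum_list ks))) = (\<Sum>ks\<in>natpermute m d. fps_nth p (n - m))"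
      using m by (intro sum.cong[OF refl]) (auto simp: natpermute_def f_def n pp nat_diff_distrib)
    then show "(\<Sum>ks\<in>natpermute m d. f (N - int (sum_list ks))) = fps_nth (g ^ d) m * fps_nth p (n - m)"
      by (simp add: gd)
  qed
  also have "\<dots> = fps_nth (g ^ d * p) n" by (simp add: fps_mult_nth)
  also have "\<dots> = 1" by (simp add: gdp) (simp add: g_def)
  finally show ?thesis using True by simp
qed

section \<open>Paths\<close>

lemma consecutive_iff:
  assumes "distinct p" "k < length p"
  shows "consecutive p (p ! k) w \<longleftrightarrow>
    (\<exists>j<length p. w = p ! j \<and> (j = Suc k \<or> k = Suc j))"
proof
  assume "consecutive p (p ! k) w"
  then obtain i where i: "Suc i < length p" "{p ! k, w} = {p ! i, p ! Suc i}"
    by (auto simp: consecutive_def)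
  then consider "p ! k = p ! i" "w = p ! Suc i" | "p ! k = p ! Suc i" "w = p ! i"
    by (auto simp: doubleton_eq_iff)
  then show "\<exists>j<length p. w = p ! j \<and> (j = Suc k \<or> k = Suc j)"
  proof cases
    case 1
    then have "k = i" using i(1) assms by (simp add: nth_eq_iff_index_eq)
    then show ?thesis using 1 i(1) by blast
  next
    case 2
    then have "k = Suc i" using i(1) assms by (simp add: nth_eq_iff_index_eq)
    then show ?thesis using 2 i(1) by (intro exI[of _ i]) simp
  qed
next
  assume "\<exists>j<length p. w = p ! j \<and> (j = Suc k \<or> k = Suc j)"
  then show "consecutive p (p ! k) w"
    using assms(2) by (auto simp: consecutive_def)
qed

lemma consecutive_nth_Suc_iff:
  assumes "distinct p" "Suc k < length p"
  shows "consecutive p (p ! Suc k) w \<longleftrightarrow>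
    w = p ! k \<or> Suc (Suc k) < length p \<and> w = p ! Suc (Suc k)"
proof -
  have "k < length p" using assms(2) by simp
  then show ?thesis
    unfolding consecutive_iff[OF assms] nat.inject by blast
qed

lemma consecutive_imp_mem: "consecutive p v w \<Longrightarrow> v \<in> set p"
  by (auto simp: consecutive_def doubleton_eq_iff)

lemma consecutive_hd_iff:
  assumes "distinct (v # xs)" "xs \<noteq> []"
  shows "consecutive (v # xs) v w \<longleftrightarrow> w = hd xs"
  using consecutive_iff[OF assms(1), of 0 w] assms(2)
  by (auto simp: hd_conv_nth)

lemma consecutive_last_iff:
  assumes "distinct (xs @ [v])" "xs \<noteq> []"
  shows "consecutive (xs @ [v]) v w \<longleftrightarrow> w = last xs"
proof -
  obtain n where n: "length xs = Suc n" using assms(2) by (cases xs) auto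
  have "consecutive (xs @ [v]) ((xs @ [v]) ! Suc n) w \<longleftrightarrow> w = (xs @ [v]) ! n"
    using consecutive_nth_Suc_iff[OF assms(1), of n w] n by simp
  then show ?thesis using n assms(2) by (simp add: nth_append last_conv_nth)
qed

text \<open>
  Used to prescribe an integer vector on a duplicate-free enumeration of the vertices.
\<close>

lemma ex_map_eq:
  assumes "distinct xs" "length ys = length xs"
  shows "\<exists>f. map f xs = ys"
  using assms
proof (induction xs arbitrary: ys)
  case (Cons x xs)
  then obtain y ys' where ys: "ys = y # ys'" by (cases ys) auto
  obtain f where "map f xs = ys'" using Cons ys by auto
  then show ?case using Cons.prems ys by (intro exI[of _ "f(x := y)"]) auto
qed simp

section \<open>Graphs with two nodes\<close>

locale two_node_tree =
  fixes G :: "'v::finite two_node_plumbing" and c :: lift_vector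
  assumes tree: "is_tree G" and neg_def: "negative_definite G" and two_nodes: "two_node_graph G"
begin

text \<open>
  The sign makes the entries of a chain at least 2, as in the continued fractions.
\<close>

definition neg_decs :: "'v list \<Rightarrow> int list" where
  "neg_decs xs = map (\<lambda>v. - dec G v) xs"

definition pairing :: "('v \<Rightarrow> int) \<Rightarrow> 'v \<Rightarrow> int" where
  "pairing l v = (\<Sum>w\<in>UNIV. imat G v w * l w)"

text \<open>
  This treats the legs of the two nodes alike: xs is a leg at the node a, and e is the lift
  coefficient of its end vertex.
\<close>

definition leg_at :: "'v \<Rightarrow> 'v list \<Rightarrow> int \<Rightarrow> bool" where
  "leg_at a xs e \<longleftrightarrow>
     (\<exists>i<length (legs G). a = node G \<and> xs = legs G ! i \<and> e = cleg c i) \<or>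
     (\<exists>j<length (legs' G). a = node' G \<and> xs = legs' G ! j \<and> e = cleg' c j)"

lemma vertices_distinct:
  "distinct (node G # node' G # link G @ concat (legs G) @ concat (legs' G))"
  using two_nodes by (simp add: two_node_graph_def)

lemma vertices_UNIV: "set (node G # node' G # link G @ concat (legs G) @ concat (legs' G)) = UNIV"
  using two_nodes unfolding two_node_graph_def by blast

lemma link_ne: "link G \<noteq> []" using two_nodes by (simp add: two_node_graph_def)

lemma legs_ne: "xs \<in> set (legs G) \<Longrightarrow> xs \<noteq> []" "xs \<in> set (legs' G) \<Longrightarrow> xs \<noteq> []"
  using two_nodes unfolding two_node_graph_def by blast+

lemma adj_iff:
  "adj G v w \<longleftrightarrow> consecutive (node G # link G @ [node' G]) v w \<or>
        (\<exists>xs \<in> set (legs G). consecutive (node G # xs) v w) \<or>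
        (\<exists>xs \<in> set (legs' G). consecutive (node' G # xs) v w)"
  using two_nodes unfolding two_node_graph_def by blast

lemma dec_le: "v \<noteq> node G \<Longrightarrow> v \<noteq> node' G \<Longrightarrow> dec G v \<le> - 2"
  using two_nodes unfolding two_node_graph_def by blast

lemma legs_distinct:
  "distinct (legs G)" "distinct (legs' G)"
  "xs \<in> set (legs G) \<Longrightarrow> distinct xs" "xs \<in> set (legs' G) \<Longrightarrow> distinct xs"
  "xs \<in> set (legs G) \<Longrightarrow> ys \<in> set (legs G) \<Longrightarrow> v \<in> set xs \<Longrightarrow> v \<in> set ys \<Longrightarrow> xs = ys"
  "xs \<in> set (legs' G) \<Longrightarrow> ys \<in> set (legs' G) \<Longrightarrow> v \<in> set xs \<Longrightarrow> v \<in> set ys \<Longrightarrow> xs = ys"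
proof -
  have d: "distinct (concat (legs G))" "distinct (concat (legs' G))" using vertices_distinct by auto
  have "removeAll [] (legs G) = legs G" "removeAll [] (legs' G) = legs' G"
    using legs_ne by (auto intro!: removeAll_id)
  then show "distinct (legs G)" "distinct (legs' G)"
    using d unfolding distinct_concat_iff by simp_all
  show "xs \<in> set (legs G) \<Longrightarrow> distinct xs" "xs \<in> set (legs' G) \<Longrightarrow> distinct xs"
    using d unfolding distinct_concat_iff by simp_all
  show "xs \<in> set (legs G) \<Longrightarrow> ys \<in> set (legs G) \<Longrightarrow> v \<in> set xs \<Longrightarrow> v \<in> set ys \<Longrightarrow> xs = ys"
    "xs \<in> set (legs' G) \<Longrightarrow> ys \<in> set (legs' G) \<Longrightarrow> v \<in> set xs \<Longrightarrow> v \<in> set ys \<Longrightarrow> xs = ys"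
    using d unfolding distinct_concat_iff by blast+
qed

lemma vertices_disjoint:
  "node G \<noteq> node' G"
  "node G \<notin> set (link G)" "node' G \<notin> set (link G)"
  "xs \<in> set (legs G) \<Longrightarrow> node G \<notin> set xs" "xs \<in> set (legs G) \<Longrightarrow> node' G \<notin> set xs"
  "xs \<in> set (legs' G) \<Longrightarrow> node G \<notin> set xs" "xs \<in> set (legs' G) \<Longrightarrow> node' G \<notin> set xs"
  "xs \<in> set (legs G) \<Longrightarrow> v \<in> set xs \<Longrightarrow> v \<notin> set (link G)"
  "xs \<in> set (legs' G) \<Longrightarrow> v \<in> set xs \<Longrightarrow> v \<notin> set (link G)"
  "xs \<in> set (legs G) \<Longrightarrow> ys \<in> set (legs' G) \<Longrightarrow> v \<in> set xs \<Longrightarrow> v \<notin> set ys"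
  using vertices_distinct by auto

lemma link_distinct: "distinct (link G)" "distinct (node G # link G @ [node' G])"
  using vertices_distinct by auto

lemma leg_atD:
  assumes "leg_at a xs e"
  shows "xs \<noteq> []" "distinct (a # xs)" "node G \<notin> set xs" "node' G \<notin> set xs"
    "v \<in> set xs \<Longrightarrow> v \<notin> set (link G)" "a = node G \<or> a = node' G"
  using assms legs_ne legs_distinct vertices_disjoint unfolding leg_at_def
  by (metis distinct.simps(2) nth_mem)+

lemma leg_at_unique:
  assumes "leg_at a xs e" "leg_at a' xs' e'" "v \<in> set xs" "v \<in> set xs'"
  shows "a = a'" "xs = xs'" "e = e'"
proof -
  have "a = a' \<and> xs = xs' \<and> e = e'"
    using assms(1) unfolding leg_at_def
  proof (elim disjE exE conjE)
    fix i assume i: "i < length (legs G)" "a = node G" "xs = legs G ! i" "e = cleg c i"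
    from assms(2) show ?thesis unfolding leg_at_def
    proof (elim disjE exE conjE)
      fix k assume k: "k < length (legs G)" "a' = node G" "xs' = legs G ! k" "e' = cleg c k"
      have "xs = xs'" using legs_distinct(5) i k assms(3,4) by (metis nth_mem)
      then show ?thesis using i k legs_distinct(1) by (metis nth_eq_iff_index_eq)
    next
      fix k assume k: "k < length (legs' G)" "a' = node' G" "xs' = legs' G ! k"
      then show ?thesis using vertices_disjoint(10) i assms(3,4) by (metis nth_mem)
    qed
  next
    fix i assume i: "i < length (legs' G)" "a = node' G" "xs = legs' G ! i" "e = cleg' c i"
    from assms(2) show ?thesis unfolding leg_at_def
    proof (elim disjE exE conjE)
      fix k assume k: "k < length (legs' G)" "a' = node' G" "xs' = legs' G ! k" "e' = cleg' c k"
      have "xs = xs'" using legs_distinct(6) i k assms(3,4) by (metis nth_mem)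
      then show ?thesis using i k legs_distinct(2) by (metis nth_eq_iff_index_eq)
    next
      fix k assume k: "k < length (legs G)" "a' = node G" "xs' = legs G ! k"
      then show ?thesis using vertices_disjoint(10) i assms(3,4) by (metis nth_mem)
    qed
  qed
  then show "a = a'" "xs = xs'" "e = e'" by auto
qed

lemma leg_at_nth:
  "i < length (legs G) \<Longrightarrow> leg_at (node G) (legs G ! i) (cleg c i)"
  "j < length (legs' G) \<Longrightarrow> leg_at (node' G) (legs' G ! j) (cleg' c j)"
  by (auto simp: leg_at_def)

lemma vertex_cases [case_names node node' link leg]:
  assumes "v = node G \<Longrightarrow> P" "v = node' G \<Longrightarrow> P"
    "\<And>k. k < length (link G) \<Longrightarrow> v = link G ! k \<Longrightarrow> P"
    "\<And>a xs e k. leg_at a xs e \<Longrightarrow> k < length xs \<Longrightarrow> v = xs ! k \<Longrightarrow> P"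
  shows P
proof -
  have "v \<in> set (node G # node' G # link G @ concat (legs G) @ concat (legs' G))"
    unfolding vertices_UNIV by simp
  then consider "v = node G" | "v = node' G" | "v \<in> set (link G)"
    | xs where "xs \<in> set (legs G)" "v \<in> set xs" | xs where "xs \<in> set (legs' G)" "v \<in> set xs"
    by auto
  then show P
  proof cases
    case 4
    then show P using assms(4)[of "node G" xs] by (auto simp: leg_at_def in_set_conv_nth)
  next
    case 5
    then show P using assms(4)[of "node' G" xs] by (auto simp: leg_at_def in_set_conv_nth)
  qed (use assms in \<open>auto simp: in_set_conv_nth\<close>)
qed

lemma adj_leg:
  assumes "leg_at a xs e" "k < length xs"
  shows "adj G (xs ! k) w \<longleftrightarrow> w = (a # xs) ! k \<or> Suc k < length xs \<and> w = xs ! Suc k"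
proof -
  let ?v = "xs ! k"
  have mem: "?v \<in> set xs" using assms(2) by simp
  note L = leg_atD[OF assms(1)]
  have "adj G ?v w \<longleftrightarrow> consecutive (a # xs) ?v w"
  proof
    assume "adj G ?v w"
    then consider "consecutive (node G # link G @ [node' G]) ?v w"
      | i where "i < length (legs G)" "consecutive (node G # legs G ! i) ?v w"
      | j where "j < length (legs' G)" "consecutive (node' G # legs' G ! j) ?v w"
      unfolding adj_iff by (metis in_set_conv_nth)
    then show "consecutive (a # xs) ?v w"
    proof cases
      case 1
      then have "?v \<in> set (node G # link G @ [node' G])" by (rule consecutive_imp_mem)
      then show ?thesis using L mem by auto
    next
      case 2
      have "?v \<in> set (node G # legs G ! i)" using 2(2) by (rule consecutive_imp_mem)
      then have "?v \<in> set (legs G ! i)" using L mem by auto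
      moreover have "leg_at (node G) (legs G ! i) (cleg c i)" using 2 by (auto simp: leg_at_def)
      ultimately show ?thesis using leg_at_unique[OF assms(1) _ mem] 2(2) by metis
    next
      case 3
      have "?v \<in> set (node' G # legs' G ! j)" using 3(2) by (rule consecutive_imp_mem)
      then have "?v \<in> set (legs' G ! j)" using L mem by auto
      moreover have "leg_at (node' G) (legs' G ! j) (cleg' c j)" using 3 by (auto simp: leg_at_def)
      ultimately show ?thesis using leg_at_unique[OF assms(1) _ mem] 3(2) by metis
    qed
  next
    assume "consecutive (a # xs) ?v w"
    then show "adj G ?v w" using assms(1) by (auto simp: leg_at_def adj_iff)
  qed
  also have "\<dots> \<longleftrightarrow> w = (a # xs) ! k \<or> Suc k < length xs \<and> w = xs ! Suc k"
    using consecutive_nth_Suc_iff[OF L(2), of k w] assms(2) by simp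
  finally show ?thesis .
qed

lemma adj_link:
  assumes "k < length (link G)"
  shows "adj G (link G ! k) w \<longleftrightarrow> w = (node G # link G) ! k \<or> w = (link G @ [node' G]) ! Suc k"
proof -
  let ?v = "link G ! k" and ?p = "node G # link G @ [node' G]"
  have mem: "?v \<in> set (link G)" using assms by simp
  have "adj G ?v w \<longleftrightarrow> consecutive ?p ?v w"
    unfolding adj_iff using mem vertices_disjoint consecutive_imp_mem by (metis set_ConsD)
  also have "consecutive ?p ?v w \<longleftrightarrow> consecutive ?p (?p ! Suc k) w"
    using assms by (simp add: nth_append)
  also have "\<dots> \<longleftrightarrow> w = ?p ! k \<or> w = (link G @ [node' G]) ! Suc k"
    using consecutive_nth_Suc_iff[OF link_distinct(2), of k w] assms by simp
  also have "?p ! k = (node G # link G) ! k"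
    using assms by (auto simp: nth_append nth_Cons split: nat.split)
  finally show ?thesis .
qed

lemma adj_node: "adj G (node G) w \<longleftrightarrow> w = hd (link G) \<or> (\<exists>xs\<in>set (legs G). w = hd xs)"
proof -
  have 1: "consecutive (node G # link G @ [node' G]) (node G) w \<longleftrightarrow> w = hd (link G)"
    using consecutive_hd_iff[OF link_distinct(2)] link_ne by simp
  have 2: "consecutive (node G # xs) (node G) w \<longleftrightarrow> w = hd xs" if "xs \<in> set (legs G)" for xs
    using that legs_ne legs_distinct vertices_disjoint by (intro consecutive_hd_iff) auto
  have 3: "\<not> consecutive (node' G # xs) (node G) w" if "xs \<in> set (legs' G)" for xs
    using that vertices_disjoint consecutive_imp_mem by (metis set_ConsD)
  show ?thesis unfolding adj_iff using 1 2 3 by auto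
qed

lemma adj_node': "adj G (node' G) w \<longleftrightarrow> w = last (link G) \<or> (\<exists>xs\<in>set (legs' G). w = hd xs)"
proof -
  have 1: "consecutive (node G # link G @ [node' G]) (node' G) w \<longleftrightarrow> w = last (link G)"
    using consecutive_last_iff[of "node G # link G" "node' G" w] link_distinct(2) link_ne by simp
  have 2: "consecutive (node' G # xs) (node' G) w \<longleftrightarrow> w = hd xs" if "xs \<in> set (legs' G)" for xs
    using that legs_ne legs_distinct vertices_disjoint by (intro consecutive_hd_iff) auto
  have 3: "\<not> consecutive (node G # xs) (node' G) w" if "xs \<in> set (legs G)" for xs
    using that vertices_disjoint consecutive_imp_mem by (metis set_ConsD)
  show ?thesis unfolding adj_iff using 1 2 3 by auto
qed

lemma pairing_eq: "pairing l v = dec G v * l v + (\<Sum>w | adj G v w. l w)"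
proof -
  have irr: "\<not> adj G v v" using tree by (auto simp: is_tree_def irreflp_def)
  have "pairing l v = imat G v v * l v + (\<Sum>w\<in>UNIV - {v}. imat G v w * l w)"
    unfolding pairing_def by (simp add: sum.remove[of _ v])
  also have "(\<Sum>w\<in>UNIV - {v}. imat G v w * l w) = (\<Sum>w | adj G v w. l w)"
    using irr by (intro sum.mono_neutral_cong_right) (auto simp: imat_def)
  finally show ?thesis by (simp add: imat_def)
qed

lemma pairing_leg:
  assumes "leg_at a xs e" "k < length xs"
  shows "pairing l (xs ! k) = dec G (xs ! k) * l (xs ! k) + l ((a # xs) ! k)
     + (if Suc k < length xs then l (xs ! Suc k) else 0)"
proof -
  have "{w. adj G (xs ! k) w} = insert ((a # xs) ! k) (if Suc k < length xs then {xs ! Suc k} else {})"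
    using adj_leg[OF assms] by auto
  moreover have "Suc k < length xs \<Longrightarrow> (a # xs) ! k \<noteq> (a # xs) ! Suc (Suc k)"
    using leg_atD(2)[OF assms(1)] by (subst nth_eq_iff_index_eq) auto
  ultimately show ?thesis by (auto simp: pairing_eq)
qed

lemma pairing_link:
  assumes "k < length (link G)"
  shows "pairing l (link G ! k) = dec G (link G ! k) * l (link G ! k) + l ((node G # link G) ! k)
     + l ((link G @ [node' G]) ! Suc k)"
proof -
  let ?p = "node G # link G @ [node' G]"
  have "{w. adj G (link G ! k) w} = {(node G # link G) ! k, (link G @ [node' G]) ! Suc k}"
    using adj_link[OF assms] by auto
  moreover have "?p ! k \<noteq> ?p ! Suc (Suc k)"
    using link_distinct(2) assms by (subst nth_eq_iff_index_eq) auto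
  moreover have "?p ! k = (node G # link G) ! k"
    using assms by (auto simp: nth_append nth_Cons split: nat.split)
  ultimately show ?thesis by (simp add: pairing_eq)
qed

lemma sum_hd_legs:
  "(\<Sum>w\<in>hd ` set (legs G). l w) = (\<Sum>i<length (legs G). l (hd (legs G ! i)) :: int)"
  "(\<Sum>w\<in>hd ` set (legs' G). l w) = (\<Sum>j<length (legs' G). l (hd (legs' G ! j)) :: int)"
proof -
  have "inj_on hd (set (legs G))" "inj_on hd (set (legs' G))"
    using legs_distinct(5,6) legs_ne by (auto intro!: inj_onI) (metis hd_in_set)+
  then have "(\<Sum>w\<in>hd ` set (legs G). l w) = (\<Sum>xs\<in>set (legs G). l (hd xs))"
    "(\<Sum>w\<in>hd ` set (legs' G). l w) = (\<Sum>xs\<in>set (legs' G). l (hd xs))"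
    by (simp_all add: sum.reindex)
  then show "(\<Sum>w\<in>hd ` set (legs G). l w) = (\<Sum>i<length (legs G). l (hd (legs G ! i)))"
    "(\<Sum>w\<in>hd ` set (legs' G). l w) = (\<Sum>j<length (legs' G). l (hd (legs' G ! j)))"
    using legs_distinct(1,2)
    by (simp_all add: sum.distinct_set_conv_list sum_list_sum_nth atLeast0LessThan)
qed

lemma pairing_node:
  "pairing l (node G) = dec G (node G) * l (node G) + l (hd (link G)) + (\<Sum>i<length (legs G). l (hd (legs G ! i)))"
proof -
  have "{w. adj G (node G) w} = insert (hd (link G)) (hd ` set (legs G))"
    using adj_node by auto
  moreover have "hd (link G) \<notin> hd ` set (legs G)"
    using vertices_disjoint(8) legs_ne(1) link_ne by (metis hd_in_set imageE)
  ultimately show ?thesis by (simp add: pairing_eq sum_hd_legs)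
qed

lemma pairing_node':
  "pairing l (node' G) = dec G (node' G) * l (node' G) + l (last (link G)) + (\<Sum>j<length (legs' G). l (hd (legs' G ! j)))"
proof -
  have "{w. adj G (node' G) w} = insert (last (link G)) (hd ` set (legs' G))"
    using adj_node' by auto
  moreover have "last (link G) \<notin> hd ` set (legs' G)"
    using vertices_disjoint(9) legs_ne(2) link_ne by (metis hd_in_set last_in_set imageE)
  ultimately show ?thesis by (simp add: pairing_eq sum_hd_legs)
qed

text \<open>
  Pairing E_v with the all-one vector counts the neighbours of v, so the valencies follow from
  the formulas for the pairing.
\<close>

lemma valency_eq: "int (valency G v) = pairing (\<lambda>_. 1) v - dec G v"
  by (simp add: pairing_eq valency_def)

lemma valency_node: "valency G (node G) = Suc (length (legs G))"
  using valency_eq[of "node G"] by (simp add: pairing_node)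

lemma valency_node': "valency G (node' G) = Suc (length (legs' G))"
  using valency_eq[of "node' G"] by (simp add: pairing_node')

lemma valency_link: "k < length (link G) \<Longrightarrow> valency G (link G ! k) = 2"
  using valency_eq[of "link G ! k"] by (simp add: pairing_link)

lemma valency_leg:
  "leg_at a xs e \<Longrightarrow> k < length xs \<Longrightarrow> valency G (xs ! k) = (if Suc k < length xs then 2 else 1)"
  using valency_eq[of "xs ! k"] by (simp add: pairing_leg split: if_splits)

lemma vertex_factor_link:
  "k < length (link G) \<Longrightarrow> vertex_factor G (link G ! k) m = (if m = 0 then 1 else 0)"
  by (auto simp: vertex_factor_def valency_link)

lemma vertex_factor_leg:
  assumes "leg_at a xs e" "k < length xs"
  shows "vertex_factor G (xs ! k) m
    = (if Suc k < length xs then if m = 0 then 1 else 0 else if 0 \<le> m then 1 else 0)"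
proof -
  have "inverse (1 - fps_X) = Abs_fps (\<lambda>_. 1 :: rat)"
    by (simp add: fps_inverse_gp'[symmetric])
  then show ?thesis
    by (auto simp: vertex_factor_def valency_leg[OF assms] power_int_def)
qed

section \<open>Determinants and Seifert invariants\<close>

lemma link_determinants:
  "alpha0 G = continuant (neg_decs (link G))"
  "omega0 G = continuant (tl (neg_decs (link G)))"
  "omega0' G = continuant (butlast (neg_decs (link G)))"
proof -
  have A: "adj G (link G ! i) (link G ! j) \<longleftrightarrow> i = Suc j \<or> j = Suc i"
    if "i < length (link G)" "j < length (link G)" for i j
  proof -
    have m: "link G ! j \<noteq> node G" "link G ! j \<noteq> node' G"
      using that vertices_disjoint(2,3) by (metis nth_mem)+
    have "link G ! j = (node G # link G) ! i \<longleftrightarrow> i = Suc j"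
      using that m(1) link_distinct(1)
      by (cases i) (auto simp: nth_eq_iff_index_eq)
    moreover have "link G ! j = (link G @ [node' G]) ! Suc i \<longleftrightarrow> j = Suc i"
      using that m(2) link_distinct(1)
      by (auto simp: nth_append nth_eq_iff_index_eq)
    ultimately show ?thesis using adj_link that by auto
  qed
  show "alpha0 G = continuant (neg_decs (link G))"
    unfolding alpha0_def neg_decs_def by (rule subgraph_det_path) (use A link_distinct in auto)
  have "subgraph_det G (tl (link G)) = continuant (map (\<lambda>v. - dec G v) (tl (link G)))"
    by (rule subgraph_det_path) (use A link_distinct in \<open>auto simp: nth_tl distinct_tl\<close>)
  then show "omega0 G = continuant (tl (neg_decs (link G)))"
    by (simp add: omega0_def neg_decs_def map_tl)
  have "subgraph_det G (butlast (link G)) = continuant (map (\<lambda>v. - dec G v) (butlast (link G)))"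
    by (rule subgraph_det_path) (use A link_distinct in \<open>auto simp: nth_butlast distinct_butlast\<close>)
  then show "omega0' G = continuant (butlast (neg_decs (link G)))"
    by (simp add: omega0'_def neg_decs_def map_butlast)
qed

lemma neg_decs_ne: "xs \<noteq> [] \<Longrightarrow> neg_decs xs \<noteq> []" by (simp add: neg_decs_def)

lemma neg_decs_ge: "node G \<notin> set xs \<Longrightarrow> node' G \<notin> set xs \<Longrightarrow> \<forall>b\<in>set (neg_decs xs). 2 \<le> b"
proof
  fix b assume "node G \<notin> set xs" "node' G \<notin> set xs" "b \<in> set (neg_decs xs)"
  then obtain v where "v \<in> set xs" "b = - dec G v" "v \<noteq> node G" "v \<noteq> node' G"
    by (auto simp: neg_decs_def)
  then show "2 \<le> b" using dec_le[of v] by simp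
qed

lemma alpha0_pos: "0 < alpha0 G"
  using continuant_gt_tl[OF neg_decs_ne[OF link_ne] neg_decs_ge] vertices_disjoint(2,3)
  unfolding link_determinants by force

lemma leg_seifert:
  assumes "leg_at a xs e"
  shows "seifert_inv G xs = (continuant (neg_decs xs), continuant (tl (neg_decs xs)))"
    and "0 < continuant (neg_decs xs)"
proof -
  note L = leg_atD[OF assms]
  show "seifert_inv G xs = (continuant (neg_decs xs), continuant (tl (neg_decs xs)))"
    unfolding neg_decs_def using L dec_le by (intro seifert_inv_eq) metis+
  show "0 < continuant (neg_decs xs)"
    using continuant_gt_tl[OF neg_decs_ne[OF L(1)] neg_decs_ge[OF L(3,4)]] by simp
qed

section \<open>Coordinates of a lift and its integer translates\<close>

definition lift_coord :: "'v \<Rightarrow> int" where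
  "lift_coord v = (if v = node G then c0 c else 0) + (if v = node' G then c0' c else 0)
     + (if v = hd (link G) then cbar c else 0)
     + (\<Sum>i<length (legs G). if v = last (legs G ! i) then cleg c i else 0)
     + (\<Sum>j<length (legs' G). if v = last (legs' G ! j) then cleg' c j else 0)"

lemma coord_lift_elem: "coord G (lift_elem G c) v = of_int (lift_coord v)"
  unfolding lift_elem_def coord_add coord_scale coord_sum coord_dual_vec[OF neg_def] lift_coord_def
  by (auto simp: if_distrib eq_commute[of _ v] cong: if_cong intro!: sum.cong)

lemma lift_coord_nodes: "lift_coord (node G) = c0 c" "lift_coord (node' G) = c0' c"
proof -
  have "hd (link G) \<in> set (link G)" using link_ne by simp
  moreover have "i < length (legs G) \<Longrightarrow> last (legs G ! i) \<in> set (legs G ! i)"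
    "i < length (legs' G) \<Longrightarrow> last (legs' G ! i) \<in> set (legs' G ! i)" for i
    using legs_ne by simp_all
  ultimately have ne: "node G \<noteq> hd (link G)" "node' G \<noteq> hd (link G)"
     "i < length (legs G) \<Longrightarrow> node G \<noteq> last (legs G ! i)"
     "i < length (legs G) \<Longrightarrow> node' G \<noteq> last (legs G ! i)"
     "i < length (legs' G) \<Longrightarrow> node G \<noteq> last (legs' G ! i)"
     "i < length (legs' G) \<Longrightarrow> node' G \<noteq> last (legs' G ! i)" for i
    using vertices_disjoint by (metis nth_mem)+
  show "lift_coord (node G) = c0 c" "lift_coord (node' G) = c0' c"
    unfolding lift_coord_def using ne vertices_disjoint(1) by simp_all
qed

lemma lift_coord_link:
  assumes "k < length (link G)"
  shows "lift_coord (link G ! k) = (if k = 0 then cbar c else 0)"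
proof -
  have m: "link G ! k \<in> set (link G)" using assms by simp
  have "i < length (legs G) \<Longrightarrow> link G ! k \<noteq> last (legs G ! i)"
     "i < length (legs' G) \<Longrightarrow> link G ! k \<noteq> last (legs' G ! i)" for i
    using m legs_ne vertices_disjoint(8,9) by (metis nth_mem last_in_set)+
  moreover have "link G ! k \<noteq> node G" "link G ! k \<noteq> node' G"
    using m vertices_disjoint(2,3) by auto
  moreover have "link G ! k = hd (link G) \<longleftrightarrow> k = 0"
    using assms link_ne link_distinct(1) by (simp add: hd_conv_nth nth_eq_iff_index_eq)
  ultimately show ?thesis unfolding lift_coord_def by simp
qed

lemma lift_coord_leg:
  assumes "leg_at a xs e" "k < length xs"
  shows "lift_coord (xs ! k) = (if Suc k < length xs then 0 else e)"
proof -
  have m: "xs ! k \<in> set xs" using assms by simp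
  note L = leg_atD[OF assms(1)]
  have last: "xs ! k = last xs \<longleftrightarrow> \<not> Suc k < length xs"
    using L(1,2) assms(2) by (auto simp: last_conv_nth nth_eq_iff_index_eq)
  have ne: "xs ! k \<noteq> node G" "xs ! k \<noteq> node' G" "xs ! k \<noteq> hd (link G)"
    using m L link_ne by (metis hd_in_set)+
  have other: "ys = xs \<and> a' = a"
    if "leg_at a' ys e'" "xs ! k = last ys" for ys a' e'
    using leg_at_unique[OF that(1) assms(1) _ m] leg_atD(1)[OF that(1)] that(2) by auto
  have s: "(\<Sum>i<length (legs G). if xs ! k = last (legs G ! i) then cleg c i else 0)
     = (if a = node G \<and> \<not> Suc k < length xs then e else 0)"
  proof (cases "a = node G \<and> \<not> Suc k < length xs")
    case True
    then obtain i where i: "i < length (legs G)" "xs = legs G ! i" "e = cleg c i"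
      using assms(1) vertices_disjoint(1) by (auto simp: leg_at_def)
    have eq: "xs ! k = last (legs G ! j) \<longleftrightarrow> j = i" if "j < length (legs G)" for j
      using other[OF leg_at_nth(1)[OF that]] i True last that legs_distinct(1) by (metis nth_eq_iff_index_eq)
    have "(\<Sum>j<length (legs G). if xs ! k = last (legs G ! j) then cleg c j else 0)
      = (\<Sum>j<length (legs G). if j = i then cleg c j else 0)"
      using eq by (intro sum.cong) auto
    then show ?thesis using True i by simp
  next
    case False
    then have "xs ! k \<noteq> last (legs G ! j)" if "j < length (legs G)" for j
      using other[OF leg_at_nth(1)[OF that]] last by auto
    then show ?thesis using False by (intro trans[OF sum.neutral]) auto
  qed
  have s': "(\<Sum>i<length (legs' G). if xs ! k = last (legs' G ! i) then cleg' c i else 0)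
     = (if a = node' G \<and> \<not> Suc k < length xs then e else 0)"
  proof (cases "a = node' G \<and> \<not> Suc k < length xs")
    case True
    then obtain i where i: "i < length (legs' G)" "xs = legs' G ! i" "e = cleg' c i"
      using assms(1) vertices_disjoint(1) by (auto simp: leg_at_def)
    have eq: "xs ! k = last (legs' G ! j) \<longleftrightarrow> j = i" if "j < length (legs' G)" for j
      using other[OF leg_at_nth(2)[OF that]] i True last that legs_distinct(2) by (metis nth_eq_iff_index_eq)
    have "(\<Sum>j<length (legs' G). if xs ! k = last (legs' G ! j) then cleg' c j else 0)
      = (\<Sum>j<length (legs' G). if j = i then cleg' c j else 0)"
      using eq by (intro sum.cong) auto
    then show ?thesis using True i by simp
  next
    case False
    then have "xs ! k \<noteq> last (legs' G ! j)" if "j < length (legs' G)" for j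
      using other[OF leg_at_nth(2)[OF that]] last by auto
    then show ?thesis using False by (intro trans[OF sum.neutral]) auto
  qed
  show ?thesis unfolding lift_coord_def s s' using ne L(6) vertices_disjoint(1) by auto
qed

text \<open>
  The coordinates of the lift plus l; these are the integers n_v(l) of the introduction.
\<close>

definition translate_coord :: "('v \<Rightarrow> int) \<Rightarrow> 'v \<Rightarrow> int" where
  "translate_coord l v = lift_coord v - pairing l v"

lemma coord_translate: "coord G (\<lambda>u. lift_elem G c u + of_int (l u)) v = of_int (translate_coord l v)"
proof -
  have sym: "imat G u w = imat G w u" for u w
    using tree by (auto simp: is_tree_def imat_def symp_def)
  have "(\<Sum>u\<in>UNIV. l u * imat G u v) = pairing l v"
    unfolding pairing_def by (intro sum.cong) (auto simp: sym mult.commute)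
  then show ?thesis
    unfolding coord_add coord_of_int coord_lift_elem translate_coord_def by simp
qed

text \<open>
  Append a fictitious vertex with value z after the end of the leg. The recursion then also
  holds at the end vertex, and z equals the coordinate there minus the lift coefficient e.
\<close>

lemma leg_solution_iff:
  assumes "leg_at a xs e"
  shows "propagate (neg_decs xs) (l a) (l (hd xs)) = map l xs @ [z] \<longleftrightarrow>
    (\<forall>k<length xs. if Suc k < length xs then translate_coord l (xs ! k) = 0 else translate_coord l (xs ! k) = z + e)"
proof -
  note L = leg_atD[OF assms]
  have "propagate (neg_decs xs) (l a) (l (hd xs)) = map l xs @ [z] \<longleftrightarrow>
    (\<forall>k<length (neg_decs xs). (l a # map l xs @ [z]) ! k + (l a # map l xs @ [z]) ! Suc (Suc k)
       = neg_decs xs ! k * map l xs ! k)"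
    using propagate_iff[of "map l xs" "neg_decs xs" "l a" z] L(1) by (simp add: neg_decs_def hd_map)
  also have "\<dots> \<longleftrightarrow> (\<forall>k<length xs. if Suc k < length xs then translate_coord l (xs ! k) = 0 else translate_coord l (xs ! k) = z + e)"
  proof -
    have "(l a # map l xs @ [z]) ! k + (l a # map l xs @ [z]) ! Suc (Suc k) = neg_decs xs ! k * map l xs ! k
      \<longleftrightarrow> (if Suc k < length xs then translate_coord l (xs ! k) = 0 else translate_coord l (xs ! k) = z + e)"
      if k: "k < length xs" for k
    proof -
      have 1: "(l a # map l xs @ [z]) ! k = l ((a # xs) ! k)"
        using k by (cases k) (auto simp: nth_append)
      have 2: "(l a # map l xs @ [z]) ! Suc (Suc k) = (if Suc k < length xs then l (xs ! Suc k) else z)"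
        using k by (auto simp: nth_append nth_Cons split: nat.split)
      show ?thesis unfolding 1 2 translate_coord_def pairing_leg[OF assms k] lift_coord_leg[OF assms k]
        using k by (auto simp: neg_decs_def)
    qed
    then show ?thesis by (simp add: neg_decs_def)
  qed
  finally show ?thesis .
qed

text \<open>
  The lift has the coefficient cbar at the first vertex of the link. In the equation of that
  vertex it can be absorbed into the value at the adjacent node, which turns all equations of the
  link into homogeneous ones.
\<close>

lemma link_solution_iff:
  "propagate (neg_decs (link G)) (l (node G) - cbar c) (l (hd (link G))) = map l (link G) @ [l (node' G)] \<longleftrightarrow>
    (\<forall>k<length (link G). translate_coord l (link G ! k) = 0)"
proof -
  let ?U = "(l (node G) - cbar c) # map l (link G) @ [l (node' G)]"
  have "propagate (neg_decs (link G)) (l (node G) - cbar c) (l (hd (link G))) = map l (link G) @ [l (node' G)] \<longleftrightarrow>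
    (\<forall>k<length (neg_decs (link G)). ?U ! k + ?U ! Suc (Suc k) = neg_decs (link G) ! k * map l (link G) ! k)"
    using propagate_iff[of "map l (link G)" "neg_decs (link G)"] link_ne by (simp add: neg_decs_def hd_map)
  also have "\<dots> \<longleftrightarrow> (\<forall>k<length (link G). translate_coord l (link G ! k) = 0)"
  proof -
    have "?U ! k + ?U ! Suc (Suc k) = neg_decs (link G) ! k * map l (link G) ! k
      \<longleftrightarrow> translate_coord l (link G ! k) = 0" if k: "k < length (link G)" for k
    proof -
      have 1: "?U ! k = l ((node G # link G) ! k) - (if k = 0 then cbar c else 0)"
        using k by (cases k) (auto simp: nth_append)
      have 2: "?U ! Suc (Suc k) = l ((link G @ [node' G]) ! Suc k)"
        using k by (auto simp: nth_append nth_Cons split: nat.split)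
      show ?thesis unfolding 1 2 translate_coord_def pairing_link[OF k] lift_coord_link[OF k]
        using k by (auto simp: neg_decs_def)
    qed
    then show ?thesis by (simp add: neg_decs_def)
  qed
  finally show ?thesis .
qed

section \<open>Solutions along the legs\<close>

definition leg_floor :: "'v list \<Rightarrow> int \<Rightarrow> int \<Rightarrow> int" where
  "leg_floor xs e r = (e - continuant (tl (neg_decs xs)) * r) div continuant (neg_decs xs)"

definition leg_solution :: "('v \<Rightarrow> int) \<Rightarrow> 'v list \<Rightarrow> bool" where
  "leg_solution l xs \<longleftrightarrow>
    (\<forall>k<length xs. if Suc k < length xs then translate_coord l (xs ! k) = 0 else 0 \<le> translate_coord l (xs ! k))"

lemma leg_solution_propagate:
  assumes "leg_at a xs e" "leg_solution l xs"
  shows "propagate (neg_decs xs) (l a) (l (hd xs)) = map l xs @ [translate_coord l (last xs) - e]"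
  unfolding leg_solution_iff[OF assms(1)]
proof (intro allI impI)
  fix k assume k: "k < length xs"
  have "\<not> Suc k < length xs \<Longrightarrow> xs ! k = last xs"
    using k by (metis Suc_lessI diff_Suc_1 last_conv_nth list.size(3) not_less_zero)
  then show "if Suc k < length xs then translate_coord l (xs ! k) = 0 else translate_coord l (xs ! k) = translate_coord l (last xs) - e + e"
    using assms(2) k by (auto simp: leg_solution_def)
qed

text \<open>
  The right-hand side is the coordinate at the end vertex when y is the value next to the node.
  It equals \<alpha> y plus the numerator of the floor, so it is nonnegative exactly if y plus the floor
  is.
\<close>

lemma leg_floor_nonneg_iff:
  assumes "leg_at a xs e"
  shows "0 \<le> leg_floor xs e r + y \<longleftrightarrow>
    0 \<le> continuant (neg_decs xs) * y - continuant (tl (neg_decs xs)) * r + e"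
proof -
  let ?K = "continuant (neg_decs xs)" and ?K' = "continuant (tl (neg_decs xs))"
  have K: "0 < ?K" by (rule leg_seifert(2)[OF assms])
  have "leg_floor xs e r + y = (e - ?K' * r + ?K * y) div ?K"
    unfolding leg_floor_def using K by simp
  then show ?thesis using pos_imp_zdiv_nonneg_iff[OF K, of "e - ?K' * r + ?K * y"]
    by (simp add: algebra_simps)
qed

lemma leg_solution_floor:
  assumes "leg_at a xs e" "leg_solution l xs"
  shows "0 \<le> leg_floor xs e (l a) + l (hd xs)"
proof -
  note L = leg_atD[OF assms(1)]
  have "translate_coord l (last xs) - e = continuant (neg_decs xs) * l (hd xs) - continuant (tl (neg_decs xs)) * l a"
    using last_propagate[OF neg_decs_ne[OF L(1)], of "l a" "l (hd xs)"] leg_solution_propagate[OF assms]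
    by simp
  moreover have "0 \<le> translate_coord l (last xs)"
    using assms(2) L(1) by (auto simp: leg_solution_def last_conv_nth dest: spec[of _ "length xs - 1"])
  ultimately show ?thesis unfolding leg_floor_nonneg_iff[OF assms(1)] by simp
qed

text \<open>
  Conversely, every natural number k is the parameter of a solution along the leg: propagate from
  the node with the initial value that k prescribes.
\<close>

lemma leg_solution_construct:
  assumes "leg_at a xs e"
    and xs: "map l xs = butlast (propagate (neg_decs xs) (l a) (int k - leg_floor xs e (l a)))"
  shows "l (hd xs) = int k - leg_floor xs e (l a)" and "leg_solution l xs"
proof -
  note L = leg_atD[OF assms(1)]
  let ?y = "int k - leg_floor xs e (l a)"
  \<comment> \<open>the last entry of this list is the value at the fictitious vertex after the end\<close>
  let ?p = "propagate (neg_decs xs) (l a) ?y"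
  have p: "?p = map l xs @ [last ?p]" unfolding xs by simp
  then have "hd ?p = l (hd xs)" using L(1) by (metis hd_append2 hd_map list.map_disc_iff)
  then show y: "l (hd xs) = ?y" by simp
  have "propagate (neg_decs xs) (l a) (l (hd xs)) = map l xs @ [last ?p]" using p y by simp
  then have "\<forall>k<length xs. if Suc k < length xs then translate_coord l (xs ! k) = 0 else translate_coord l (xs ! k) = last ?p + e"
    unfolding leg_solution_iff[OF assms(1)] .
  moreover have "0 \<le> last ?p + e"
    unfolding last_propagate[OF neg_decs_ne[OF L(1)]]
    using leg_floor_nonneg_iff[OF assms(1), of "l a" ?y] by simp
  ultimately show "leg_solution l xs" by (simp add: leg_solution_def)
qed

section \<open>Vectors contributing to Z\<close>

text \<open>
  The integer vectors with values r and r' at the nodes for which every vertex other than the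
  nodes contributes the factor 1.
\<close>

definition solutions :: "int \<Rightarrow> int \<Rightarrow> ('v \<Rightarrow> int) set" where
  "solutions r r' = {l. l (node G) = r \<and> l (node' G) = r' \<and>
     (\<forall>k<length (link G). translate_coord l (link G ! k) = 0) \<and> (\<forall>a xs e. leg_at a xs e \<longrightarrow> leg_solution l xs)}"

lemma solutionsD:
  assumes "l \<in> solutions r r'"
  shows "l (node G) = r" "l (node' G) = r'" "leg_at a xs e \<Longrightarrow> leg_solution l xs"
  using assms unfolding solutions_def by blast+

definition weight :: "('v \<Rightarrow> int) \<Rightarrow> rat" where
  "weight l = (\<Prod>v\<in>UNIV. vertex_factor G v (translate_coord l v))"

lemma weight_eq:
  "weight l = (if l \<in> solutions (l (node G)) (l (node' G))
     then vertex_factor G (node G) (translate_coord l (node G)) * vertex_factor G (node' G) (translate_coord l (node' G)) else 0)"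
proof (cases "l \<in> solutions (l (node G)) (l (node' G))")
  case True
  have "vertex_factor G v (translate_coord l v) = 1" if "v \<noteq> node G" "v \<noteq> node' G" for v
  proof (cases v rule: vertex_cases)
    case (link k)
    then show ?thesis using True by (simp add: solutions_def vertex_factor_link)
  next
    case (leg a xs e k)
    then have "leg_solution l xs" using True by (auto simp: solutions_def)
    then show ?thesis using leg by (auto simp: leg_solution_def vertex_factor_leg)
  qed (use that in auto)
  then have "weight l = (\<Prod>v\<in>{node G, node' G}. vertex_factor G v (translate_coord l v))"
    unfolding weight_def by (intro prod.mono_neutral_right) auto
  then show ?thesis using True vertices_disjoint(1) by simp
next
  case False
  then consider k where "k < length (link G)" "translate_coord l (link G ! k) \<noteq> 0"
    | a xs e where "leg_at a xs e" "\<not> leg_solution l xs"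
    by (auto simp: solutions_def)
  then have "\<exists>v. vertex_factor G v (translate_coord l v) = 0"
  proof cases
    case 1
    then have "vertex_factor G (link G ! k) (translate_coord l (link G ! k)) = 0" by (simp add: vertex_factor_link)
    then show ?thesis ..
  next
    case 2
    then obtain k where k: "k < length xs"
      "\<not> (if Suc k < length xs then translate_coord l (xs ! k) = 0 else 0 \<le> translate_coord l (xs ! k))"
      by (auto simp: leg_solution_def)
    then have "vertex_factor G (xs ! k) (translate_coord l (xs ! k)) = 0"
      unfolding vertex_factor_leg[OF 2(1) k(1)] by (auto split: if_splits)
    then show ?thesis ..
  qed
  then have "weight l = 0" by (auto simp: weight_def)
  then show ?thesis using False by simp
qed

text \<open>
  Each node sees the link only through its adjacent link vertex. Forward propagation computes the
  value there for the first node, backward propagation for the second.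
\<close>

lemma solutions_link:
  assumes "l \<in> solutions r r'"
  shows "propagate (neg_decs (link G)) (r - cbar c) (l (hd (link G))) = map l (link G) @ [r']"
    and "alpha0 G * l (hd (link G)) = r' + omega0 G * (r - cbar c)"
    and "alpha0 G * l (last (link G)) = r - cbar c + omega0' G * r'"
proof -
  show p: "propagate (neg_decs (link G)) (r - cbar c) (l (hd (link G))) = map l (link G) @ [r']"
    using assms link_solution_iff[of l] by (auto simp: solutions_def)
  show "alpha0 G * l (hd (link G)) = r' + omega0 G * (r - cbar c)"
    using last_propagate[OF neg_decs_ne[OF link_ne], of "r - cbar c" "l (hd (link G))"]
    unfolding p link_determinants by simp
  show "alpha0 G * l (last (link G)) = r - cbar c + omega0' G * r'"
    using start_of_propagate[OF neg_decs_ne[OF link_ne] p] link_ne unfolding link_determinants by (simp add: last_map)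
qed

lemma solutions_cong:
  assumes "l \<in> solutions r r'"
  shows "[r + omega0' G * r' = cbar c] (mod alpha0 G)"
proof -
  have "r + omega0' G * r' - cbar c = alpha0 G * l (last (link G))"
    using solutions_link(3)[OF assms] by simp
  then show ?thesis by (simp add: cong_iff_dvd_diff)
qed

section \<open>Summation over the free parameters of the legs\<close>

text \<open>
  One parameter for each leg: the amount by which the value next to the node exceeds its minimum,
  which is the negative of the floor.
\<close>

definition leg_params :: "int \<Rightarrow> int \<Rightarrow> ('v \<Rightarrow> int) \<Rightarrow> nat list \<times> nat list" where
  "leg_params r r' l =
    (map (\<lambda>i. nat (leg_floor (legs G ! i) (cleg c i) r + l (hd (legs G ! i)))) [0..<length (legs G)],
     map (\<lambda>j. nat (leg_floor (legs' G ! j) (cleg' c j) r' + l (hd (legs' G ! j)))) [0..<length (legs' G)])"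

text \<open>
  On the link the first value is determined because alpha0 is positive, on a leg by the
  parameter. In both cases propagation determines the remaining values.
\<close>

lemma inj_on_leg_params: "inj_on (leg_params r r') (solutions r r')"
proof (rule inj_onI)
  fix l m assume l: "l \<in> solutions r r'" and m: "m \<in> solutions r r'"
    and eq: "leg_params r r' l = leg_params r r' m"
  have nodes: "l (node G) = r" "m (node G) = r" "l (node' G) = r'" "m (node' G) = r'"
    using l m by (auto simp: solutions_def)
  have "alpha0 G * l (hd (link G)) = alpha0 G * m (hd (link G))"
    using solutions_link(2)[OF l] solutions_link(2)[OF m] by simp
  then have "l (hd (link G)) = m (hd (link G))" using alpha0_pos by simp
  then have link: "map l (link G) = map m (link G)"
    using solutions_link(1)[OF l] solutions_link(1)[OF m] by simp
  have leg: "map l xs = map m xs" if at: "leg_at a xs e" for a xs e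
  proof -
    have sl: "leg_solution l xs" "leg_solution m xs" using at l m unfolding solutions_def by blast+
    have a: "l a = m a" using leg_atD(6)[OF at] nodes by auto
    have n: "0 \<le> leg_floor xs e (l a) + l (hd xs)" "0 \<le> leg_floor xs e (l a) + m (hd xs)"
      using leg_solution_floor[OF at sl(1)] leg_solution_floor[OF at sl(2)] a by auto
    have "nat (leg_floor xs e (l a) + l (hd xs)) = nat (leg_floor xs e (l a) + m (hd xs))"
      using at eq nodes unfolding leg_at_def leg_params_def by auto
    then have "l (hd xs) = m (hd xs)" using n by simp
    then show ?thesis
      using leg_solution_propagate[OF at sl(1)] leg_solution_propagate[OF at sl(2)] a by simp
  qed
  show "l = m"
  proof
    fix v show "l v = m v"
    proof (cases v rule: vertex_cases)
      case (link k)
      then show ?thesis using \<open>map l (link G) = map m (link G)\<close> by (metis nth_map)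
    next
      case (leg a xs e k)
      then show ?thesis using \<open>\<And>a xs e. leg_at a xs e \<Longrightarrow> map l xs = map m xs\<close> by (metis nth_map)
    qed (use nodes in auto)
  qed
qed

text \<open>
  The nodes, the link and the legs partition the vertices, so values can be prescribed on them
  independently.
\<close>

lemma ex_vertex_values:
  assumes "length us = length (link G)" "map length yss = map length (legs G)"
    "map length yss' = map length (legs' G)"
  shows "\<exists>l. l (node G) = r \<and> l (node' G) = r' \<and> map l (link G) = us \<and>
    map (map l) (legs G) = yss \<and> map (map l) (legs' G) = yss'"
proof -
  have len: "length (concat yss) = length (concat (legs G))"
    "length (concat yss') = length (concat (legs' G))"
    using assms(2,3) by (simp_all add: length_concat)
  then obtain l where l: "map l (node G # node' G # link G @ concat (legs G) @ concat (legs' G))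
      = r # r' # us @ concat yss @ concat yss'"
    using ex_map_eq[OF vertices_distinct, of "r # r' # us @ concat yss @ concat yss'"] assms(1) by auto
  moreover have len': "length (concat (map (map l) (legs G))) = length (concat yss)"
    "length (concat (map (map l) (legs' G))) = length (concat yss')"
    unfolding len by (simp_all add: length_concat comp_def)
  ultimately have "map l (link G) = us" and c: "concat (map (map l) (legs G)) = concat yss"
    "concat (map (map l) (legs' G)) = concat yss'"
    using assms(1) by (auto simp: append_eq_append_conv map_concat)
  moreover have "map (map l) (legs G) = yss" "map (map l) (legs' G) = yss'"
    using c assms(2,3)
    by (auto intro!: concat_injective simp: set_zip dest: map_eq_imp_length_eq)
      (metis length_map nth_map)+
  ultimately show ?thesis using l by auto
qed

text \<open>
  The congruence is what makes the last value on the link integral; propagating backwards from it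
  and r' then arrives at r - cbar, the boundary value that link_solution_iff requires. The legs impose no condition.
\<close>

lemma leg_params_surj:
  assumes "[r + omega0' G * r' = cbar c] (mod alpha0 G)"
    and ks: "length ks = length (legs G)" "length ks' = length (legs' G)"
  shows "\<exists>l\<in>solutions r r'. leg_params r r' l = (ks, ks')"
proof -
  \<comment> \<open>the value that l will take at the last vertex of the link\<close>
  obtain x where x: "r + omega0' G * r' - cbar c = alpha0 G * x"
    using assms(1) by (auto simp: cong_iff_dvd_diff)
  obtain a us where us: "propagate (neg_decs (link G)) a (hd us) = us @ [r']"
      "length us = length (neg_decs (link G))" "last us = x"
    using propagate_backwards[OF neg_decs_ne[OF link_ne]] by blast
  have a: "a = r - cbar c"
    using start_of_propagate[OF neg_decs_ne[OF link_ne] us(1)] us(3) x unfolding link_determinants by simp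
  define ys where "ys = (\<lambda>i. butlast (propagate (neg_decs (legs G ! i)) r
    (int (ks ! i) - leg_floor (legs G ! i) (cleg c i) r)))"
  define ys' where "ys' = (\<lambda>i. butlast (propagate (neg_decs (legs' G ! i)) r'
    (int (ks' ! i) - leg_floor (legs' G ! i) (cleg' c i) r')))"
  have lens: "map length (map ys [0..<length (legs G)]) = map length (legs G)"
    "map length (map ys' [0..<length (legs' G)]) = map length (legs' G)"
    by (auto simp: ys_def ys'_def neg_decs_def intro!: nth_equalityI)
  obtain l where l: "l (node G) = r" "l (node' G) = r'" "map l (link G) = us"
    "map (map l) (legs G) = map ys [0..<length (legs G)]"
    "map (map l) (legs' G) = map ys' [0..<length (legs' G)]"
    using ex_vertex_values[of us "map ys [0..<length (legs G)]" "map ys' [0..<length (legs' G)]" r r']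
      lens us(2) by (auto simp: neg_decs_def)
  have v: "map l (legs G ! i) = ys i" if "i < length (legs G)" for i
    using arg_cong[OF l(4), of "\<lambda>zs. zs ! i"] that by simp
  have v': "map l (legs' G ! i) = ys' i" if "i < length (legs' G)" for i
    using arg_cong[OF l(5), of "\<lambda>zs. zs ! i"] that by simp
  have s: "l (hd (legs G ! i)) = int (ks ! i) - leg_floor (legs G ! i) (cleg c i) r"
      "leg_solution l (legs G ! i)" if "i < length (legs G)" for i
    using leg_solution_construct[OF leg_at_nth(1)[OF that], of l "ks ! i"] v[OF that]
    by (simp_all add: l ys_def)
  have s': "l (hd (legs' G ! i)) = int (ks' ! i) - leg_floor (legs' G ! i) (cleg' c i) r'"
      "leg_solution l (legs' G ! i)" if "i < length (legs' G)" for i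
    using leg_solution_construct[OF leg_at_nth(2)[OF that], of l "ks' ! i"] v'[OF that]
    by (simp_all add: l ys'_def)
  have "hd us = l (hd (link G))" using l(3) link_ne by (metis hd_map)
  then have "\<forall>k<length (link G). translate_coord l (link G ! k) = 0"
    using us(1) link_solution_iff[of l] l a by simp
  then have "l \<in> solutions r r'"
    using s(2) s'(2) l by (auto simp: solutions_def leg_at_def)
  moreover have "leg_params r r' l = (ks, ks')"
    using ks s(1) s'(1) by (auto simp: leg_params_def intro!: nth_equalityI)
  ultimately show ?thesis by blast
qed

text \<open>
  The coordinate at the node when all leg parameters vanish. By Nfun_eq it is the value of N_c,
  which is therefore an integer as soon as the link has an integral solution.
\<close>

definition node_bound :: "int \<Rightarrow> ('v \<Rightarrow> int) \<Rightarrow> int" where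
  "node_bound r l = c0 c - dec G (node G) * r - l (hd (link G))
     + (\<Sum>i<length (legs G). leg_floor (legs G ! i) (cleg c i) r)"

definition node_bound' :: "int \<Rightarrow> ('v \<Rightarrow> int) \<Rightarrow> int" where
  "node_bound' r' l = c0' c - dec G (node' G) * r' - l (last (link G))
     + (\<Sum>j<length (legs' G). leg_floor (legs' G ! j) (cleg' c j) r')"

lemma translate_coord_nodes:
  assumes "l \<in> solutions r r'"
  shows "translate_coord l (node G) = node_bound r l - int (sum_list (fst (leg_params r r' l)))"
    and "translate_coord l (node' G) = node_bound' r' l - int (sum_list (snd (leg_params r r' l)))"
proof -
  have nodes: "l (node G) = r" "l (node' G) = r'" using assms by (auto simp: solutions_def)
  have "int (sum_list (fst (leg_params r r' l)))
      = (\<Sum>i<length (legs G). leg_floor (legs G ! i) (cleg c i) r + l (hd (legs G ! i)))"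
    unfolding leg_params_def fst_conv interv_sum_list_conv_sum_set_nat of_nat_sum set_upt atLeast0LessThan
    using leg_solution_floor[OF leg_at_nth(1) solutionsD(3)[OF assms leg_at_nth(1)]] nodes
    by (intro sum.cong refl) auto
  then show "translate_coord l (node G) = node_bound r l - int (sum_list (fst (leg_params r r' l)))"
    by (simp add: translate_coord_def pairing_node lift_coord_nodes node_bound_def sum.distrib nodes)
  have "int (sum_list (snd (leg_params r r' l)))
      = (\<Sum>i<length (legs' G). leg_floor (legs' G ! i) (cleg' c i) r' + l (hd (legs' G ! i)))"
    unfolding leg_params_def snd_conv interv_sum_list_conv_sum_set_nat of_nat_sum set_upt atLeast0LessThan
    using leg_solution_floor[OF leg_at_nth(2) solutionsD(3)[OF assms leg_at_nth(2)]] nodes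
    by (intro sum.cong refl) auto
  then show "translate_coord l (node' G) = node_bound' r' l - int (sum_list (snd (leg_params r r' l)))"
    by (simp add: translate_coord_def pairing_node' lift_coord_nodes node_bound'_def sum.distrib nodes)
qed

lemma Nfun_eq:
  assumes "l \<in> solutions r r'"
  shows "Nfun G c r r' = of_int (node_bound r l)" "Nfun' G c r r' = of_int (node_bound' r' l)"
proof -
  let ?\<alpha> = "of_int (alpha0 G) :: rat"
  have \<alpha>: "?\<alpha> \<noteq> 0" using alpha0_pos by simp
  have "?\<alpha> * of_int (l (hd (link G))) = of_int r' + of_int (omega0 G) * (of_int r - of_int (cbar c))"
    using arg_cong[OF solutions_link(2)[OF assms], of "of_int :: int \<Rightarrow> rat"] by simp
  then have 1: "of_int (l (hd (link G))) = (of_int r' + of_int (omega0 G) * (of_int r - of_int (cbar c))) / ?\<alpha>"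
    using \<alpha> by (simp add: field_simps)
  have "?\<alpha> * of_int (l (last (link G))) = of_int r - of_int (cbar c) + of_int (omega0' G) * of_int r'"
    using arg_cong[OF solutions_link(3)[OF assms], of "of_int :: int \<Rightarrow> rat"] by simp
  then have 2: "of_int (l (last (link G))) = (of_int r - of_int (cbar c) + of_int (omega0' G) * of_int r') / ?\<alpha>"
    using \<alpha> by (simp add: field_simps)
  have s: "(\<Sum>i<length (legs G). of_int \<lfloor>of_int (cleg c i - leg_omega G i * r) / (of_int (leg_alpha G i) :: rat)\<rfloor>)
     = (of_int (\<Sum>i<length (legs G). leg_floor (legs G ! i) (cleg c i) r) :: rat)"
    unfolding of_int_sum floor_divide_of_int_eq leg_floor_def leg_alpha_def leg_omega_def
    using leg_seifert(1)[OF leg_at_nth(1)] by (intro sum.cong) auto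
  have s': "(\<Sum>i<length (legs' G). of_int \<lfloor>of_int (cleg' c i - leg_omega' G i * r') / (of_int (leg_alpha' G i) :: rat)\<rfloor>)
     = (of_int (\<Sum>i<length (legs' G). leg_floor (legs' G ! i) (cleg' c i) r') :: rat)"
    unfolding of_int_sum floor_divide_of_int_eq leg_floor_def leg_alpha'_def leg_omega'_def
    using leg_seifert(1)[OF leg_at_nth(2)] by (intro sum.cong) auto
  show "Nfun G c r r' = of_int (node_bound r l)"
    unfolding Nfun_def node_bound_def s
    unfolding of_int_add of_int_diff of_int_mult 1
    by (simp add: add_divide_distrib diff_divide_distrib algebra_simps)
  show "Nfun' G c r r' = of_int (node_bound' r' l)"
    unfolding Nfun'_def node_bound'_def s'
    unfolding of_int_add of_int_diff of_int_mult 2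
    by (simp add: add_divide_distrib diff_divide_distrib algebra_simps)
qed

lemma sum_vertex_factor:
  "(\<Sum>ks | length ks = length (legs G) \<and> vertex_factor G (node G) (N - int (sum_list ks)) \<noteq> 0.
     vertex_factor G (node G) (N - int (sum_list ks))) = (if 0 \<le> N then 1 else 0)"
  "(\<Sum>ks | length ks = length (legs' G) \<and> vertex_factor G (node' G) (N - int (sum_list ks)) \<noteq> 0.
     vertex_factor G (node' G) (N - int (sum_list ks))) = (if 0 \<le> N then 1 else 0)"
proof -
  have d: "1 \<le> length (legs G)" "1 \<le> length (legs' G)"
    using two_nodes by (auto simp: two_node_graph_def)
  have f: "vertex_factor G (node G) m =
      (if m < 0 then 0 else fps_nth ((1 - fps_X) powi (int (length (legs G)) - 1)) (nat m))" for m
    by (simp add: vertex_factor_def valency_node)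
  have f': "vertex_factor G (node' G) m =
      (if m < 0 then 0 else fps_nth ((1 - fps_X) powi (int (length (legs' G)) - 1)) (nat m))" for m
    by (simp add: vertex_factor_def valency_node')
  show "(\<Sum>ks | length ks = length (legs G) \<and> vertex_factor G (node G) (N - int (sum_list ks)) \<noteq> 0.
     vertex_factor G (node G) (N - int (sum_list ks))) = (if 0 \<le> N then 1 else 0)"
    unfolding f by (rule sum_power_coeff[OF d(1)])
  show "(\<Sum>ks | length ks = length (legs' G) \<and> vertex_factor G (node' G) (N - int (sum_list ks)) \<noteq> 0.
     vertex_factor G (node' G) (N - int (sum_list ks))) = (if 0 \<le> N then 1 else 0)"
    unfolding f' by (rule sum_power_coeff[OF d(2)])
qed

text \<open>
  If the congruence fails, no vector contributes. Otherwise the parametrization turns the sum into a product of two sums, one for each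
  node, both evaluated by the generating function.
\<close>

lemma sum_weight:
  "(\<Sum>l | l (node G) = r \<and> l (node' G) = r' \<and> weight l \<noteq> 0. weight l)
     = (if (r, r') \<in> Sset G c then 1 else 0)"
proof (cases "[r + omega0' G * r' = cbar c] (mod alpha0 G)")
  case False
  then have "solutions r r' = {}" using solutions_cong by blast
  then have "{l. l (node G) = r \<and> l (node' G) = r' \<and> weight l \<noteq> 0} = {}"
    by (auto simp: weight_eq)
  then show ?thesis using False by (auto simp: Sset_def)
next
  case True
  obtain l0 where l0: "l0 \<in> solutions r r'"
    using leg_params_surj[OF True, of "replicate (length (legs G)) 0" "replicate (length (legs' G)) 0"] by auto
  \<comment> \<open>the bounds depend on l only through the link, where all solutions agree\<close>
  define N N' where "N = node_bound r l0" and "N' = node_bound' r' l0"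
  have NN: "node_bound r l = N" "node_bound' r' l = N'" if "l \<in> solutions r r'" for l
    using Nfun_eq[OF that] Nfun_eq[OF l0] by (simp_all add: N_def N'_def)
  define f where "f = (\<lambda>ks. vertex_factor G (node G) (N - int (sum_list ks)))"
  define f' where "f' = (\<lambda>ks. vertex_factor G (node' G) (N' - int (sum_list ks)))"
  define A where "A = {ks. length ks = length (legs G) \<and> f ks \<noteq> 0}"
  define A' where "A' = {ks. length ks = length (legs' G) \<and> f' ks \<noteq> 0}"
  let ?P = "leg_params r r'"
  let ?L = "{l. l (node G) = r \<and> l (node' G) = r' \<and> weight l \<noteq> 0}"
  have w: "weight l = f (fst (?P l)) * f' (snd (?P l))" if "l \<in> solutions r r'" for l
  proof -
    have "l \<in> solutions (l (node G)) (l (node' G))" using that by (auto simp: solutions_def)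
    then show ?thesis
      unfolding weight_eq f_def f'_def translate_coord_nodes[OF that] NN[OF that] by simp
  qed
  have L: "?L = {l \<in> solutions r r'. weight l \<noteq> 0}"
    by (auto simp: weight_eq solutions_def split: if_splits)
  have len: "length (fst (?P l)) = length (legs G)" "length (snd (?P l)) = length (legs' G)" for l
    by (simp_all add: leg_params_def)
  have "bij_betw ?P ?L (A \<times> A')"
    unfolding bij_betw_def
  proof
    show "inj_on ?P ?L" using inj_on_leg_params unfolding L by (rule inj_on_subset) auto
    show "?P ` ?L = A \<times> A'"
    proof
      show "?P ` ?L \<subseteq> A \<times> A'"
      proof (rule image_subsetI)
        fix l assume "l \<in> ?L"
        then have "l \<in> solutions r r'" "weight l \<noteq> 0" unfolding L by auto
        then have "fst (?P l) \<in> A" "snd (?P l) \<in> A'" using w len by (auto simp: A_def A'_def)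
        then show "?P l \<in> A \<times> A'" by (simp add: mem_Times_iff)
      qed
      show "A \<times> A' \<subseteq> ?P ` ?L"
      proof
        fix p assume "p \<in> A \<times> A'"
        then obtain ks ks' where p: "p = (ks, ks')" "ks \<in> A" "ks' \<in> A'" by auto
        then obtain l where l: "l \<in> solutions r r'" "?P l = (ks, ks')"
          using leg_params_surj[OF True, of ks ks'] by (auto simp: A_def A'_def)
        then have "weight l \<noteq> 0" using w p by (auto simp: A_def A'_def)
        then show "p \<in> ?P ` ?L" using l p unfolding L by (intro image_eqI[of _ _ l]) auto
      qed
    qed
  qed
  then have "(\<Sum>p\<in>A \<times> A'. f (fst p) * f' (snd p)) = (\<Sum>l\<in>?L. f (fst (?P l)) * f' (snd (?P l)))"
    by (rule sum.reindex_bij_betw[symmetric])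
  also have "\<dots> = (\<Sum>l\<in>?L. weight l)" using w unfolding L by (intro sum.cong) auto
  finally have "(\<Sum>l\<in>?L. weight l) = (\<Sum>p\<in>A \<times> A'. f (fst p) * f' (snd p))" ..
  also have "\<dots> = (\<Sum>ks\<in>A. f ks) * (\<Sum>ks\<in>A'. f' ks)"
    unfolding sum_product sum.cartesian_product by (simp add: case_prod_beta)
  also have "\<dots> = (if 0 \<le> N then 1 else 0) * (if 0 \<le> N' then 1 else 0)"
    unfolding A_def A'_def f_def f'_def sum_vertex_factor ..
  also have "\<dots> = (if (r, r') \<in> Sset G c then 1 else 0)"
    using True Nfun_eq[OF l0] by (simp add: Sset_def N_def N'_def)
  finally show ?thesis .
qed

section \<open>The reduced series\<close>

lemma shift_eq: "shift G c = lift_elem G c (node G)" "shift' G c = lift_elem G c (node' G)"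
proof -
  have "- iform G (dual_vec G v) x = x v" for v x
  proof -
    have "- iform G (dual_vec G v) x = (\<Sum>w\<in>UNIV. if v = w then x w else 0)"
      unfolding iform_eq_coord coord_dual_vec[OF neg_def] minus_minus by (intro sum.cong) auto
    then show ?thesis by simp
  qed
  then show "shift G c = lift_elem G c (node G)" "shift' G c = lift_elem G c (node' G)"
    by (simp_all add: shift_def shift'_def)
qed

text \<open>
  The exponents in the class h are the integer translates of the lift, and the pairing with the
  dual vector of a node reads off the coefficient at that node.
\<close>

lemma Zseries_nodes_eq:
  assumes h: "lclass G (lift_elem G c) = h"
  shows "Zseries_nodes G h (y, y') = (\<Sum>l | of_int (l (node G)) + shift G c = y \<and>
    of_int (l (node' G)) + shift' G c = y' \<and> weight l \<noteq> 0. weight l)"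
proof -
  have dual: "lift_elem G c \<in> dual_lattice G"
    by (simp add: dual_lattice_iff coord_lift_elem)
  define T :: "('v \<Rightarrow> int) \<Rightarrow> 'v \<Rightarrow> rat" where "T l = (\<lambda>u. lift_elem G c u + of_int (l u))" for l
  let ?L = "{l. of_int (l (node G)) + shift G c = y \<and> of_int (l (node' G)) + shift' G c = y' \<and> weight l \<noteq> 0}"
  have part: "Zseries_part G h x = (if x \<in> range T then Zseries G x else 0)" for x
    using lclass_eq_iff[OF dual, of x] by (auto simp: Zseries_part_eq h[symmetric] T_def)
  have ZT: "Zseries G (T l) = weight l" for l
    unfolding T_def weight_def by (rule Zseries_coeff[OF neg_def coord_translate])
  have pT: "Zseries_part G h (T l) = weight l" for l by (simp add: part ZT)
  have Tn: "T l (node G) = of_int (l (node G)) + shift G c"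
    "T l (node' G) = of_int (l (node' G)) + shift' G c" for l
    by (simp_all add: T_def shift_eq)
  have inj: "inj_on T ?L" by (auto simp: T_def inj_on_def fun_eq_iff)
  have "{x. x \<in> UNIV \<and> (x (node G), x (node' G)) = (y, y') \<and> Zseries_part G h x \<noteq> 0} = T ` ?L"
  proof (intro equalityI subsetI)
    fix x assume x: "x \<in> {x. x \<in> UNIV \<and> (x (node G), x (node' G)) = (y, y') \<and> Zseries_part G h x \<noteq> 0}"
    then obtain l where l: "x = T l" by (auto simp: part split: if_splits)
    then have "l \<in> ?L" using x by (simp add: pT Tn)
    then show "x \<in> T ` ?L" using l by blast
  next
    fix x assume "x \<in> T ` ?L"
    then show "x \<in> {x. x \<in> UNIV \<and> (x (node G), x (node' G)) = (y, y') \<and> Zseries_part G h x \<noteq> 0}"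
      by (auto simp: pT Tn)
  qed
  then have "Zseries_nodes G h (y, y') = (\<Sum>x\<in>T ` ?L. Zseries_part G h x)"
    unfolding Zseries_nodes_def formal_sum_fmonom by simp
  also have "\<dots> = (\<Sum>l\<in>?L. weight l)"
    by (subst sum.reindex[OF inj]) (simp add: pT)
  finally show ?thesis .
qed

end

theorem theorem7p2p2:
  fixes G :: "'v::finite two_node_plumbing"
    and h :: "('v \<Rightarrow> rat) set"
    and c :: lift_vector
  assumes "is_tree G"
    and "negative_definite G"
    and "two_node_graph G"
    and "h \<in> disc_group G"
    and "gives_lift G c h"
  shows "Zseries_nodes G h =
    formal_sum (Sset G c)
      (\<lambda>(l, l'). fmonom 1 (of_int l + shift G c, of_int l' + shift' G c))"
proof
  interpret two_node_tree G c using assms by unfold_locales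
  have h: "lclass G (lift_elem G c) = h" using assms(5) by (simp add: gives_lift_def)
  fix p :: "rat \<times> rat"
  obtain y y' where p: "p = (y, y')" by fastforce
  let ?e = "\<lambda>q. (of_int (fst q) + shift G c, of_int (snd q) + shift' G c)"
  have rhs: "formal_sum (Sset G c) (\<lambda>(l, l'). fmonom 1 (of_int l + shift G c, of_int l' + shift' G c)) p
      = (\<Sum>q | q \<in> Sset G c \<and> ?e q = p. 1)"
    using formal_sum_fmonom[of "Sset G c" "\<lambda>_. 1" ?e p] by (simp add: case_prod_beta')
  show "Zseries_nodes G h p =
    formal_sum (Sset G c) (\<lambda>(l, l'). fmonom 1 (of_int l + shift G c, of_int l' + shift' G c)) p"
  proof (cases "\<exists>r r'. p = ?e (r, r')")
    case True
    then obtain r r' where e: "p = ?e (r, r')" by blast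
    \<comment> \<open>the shift of exponents is injective, so at most one pair contributes\<close>
    have "{q. q \<in> Sset G c \<and> ?e q = p} = (if (r, r') \<in> Sset G c then {(r, r')} else {})"
      by (auto simp: e)
    then have "(\<Sum>q | q \<in> Sset G c \<and> ?e q = p. 1) = (if (r, r') \<in> Sset G c then 1 else (0::rat))" by simp
    moreover have "Zseries_nodes G h p = (if (r, r') \<in> Sset G c then 1 else 0)"
      unfolding e fst_conv snd_conv Zseries_nodes_eq[OF h] using sum_weight[of r r'] by simp
    ultimately show ?thesis using rhs by simp
  next
    case False
    then have "{q. q \<in> Sset G c \<and> ?e q = p} = {}" by auto
    then have "(\<Sum>q | q \<in> Sset G c \<and> ?e q = p. 1) = (0::rat)" by (simp only: sum.empty)
    moreover have "{l. of_int (l (node G)) + shift G c = y \<and> of_int (l (node' G)) + shift' G c = y' \<and> weight l \<noteq> 0} = {}"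
      using False p by auto
    then have "Zseries_nodes G h p = 0"
      unfolding p Zseries_nodes_eq[OF h] by (simp only: sum.empty)
    ultimately show ?thesis using rhs by simp
  qed
qed

end
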